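(* Let $V$ be a vector space and $f:V\to V$ a linear endomorphism whose transpose $f^*:V^*\to V^*$ is locally nilpotent. Let $G$ be the group of characters of the Hopf algebra $S(T(V^*,f^* ))$, with its product denoted $\diamond$, and regard $\overline{T}(V)=\prod_{n\ge 0}V^{\otimes n}$ as a subset of $G$. Define inductively a composition $\tilde\diamond$ on $\overline{T}(V)$, linear and continuous in its left argument, by: for all $v\in\overline{T}(V)$, 1. $\emptyset\,\tilde\diamond\, v=\emptyset$; 2. if $x\in V$ and $u\in\overline{T}(V)$, $\displaystyle (xu)\,\tilde\diamond\, v=\sum_{i\ge 0}f^i(x)\big((u\,\tilde\diamond\, v)\sqcup\!\sqcup v^{\sqcup\!\sqcup i}\big)$. Then for all $u,v\in\overline{T}(V)$, $u\diamond v=u\,\tilde\diamond\, v+v$.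
   Context: $\mathbb{K}$ is a field of characteristic zero. For a vector space $W$, $T(W)=\bigoplus_{n\ge 0}W^{\otimes n}$ is spanned by words with letters in $W$; $\emptyset$ is the empty word; juxtaposition is concatenation. The shuffle product $\sqcup\!\sqcup$ is the bilinear product with unit $\emptyset$ and $xu\sqcup\!\sqcup yv=x(u\sqcup\!\sqcup yv)+y(xu\sqcup\!\sqcup v)$; it and concatenation extend by continuity to $\overline{T}(V)=\prod_{n\ge 0}V^{\otimes n}$, which carries its usual ultrametric topology (given by the length of words). $v^{\sqcup\!\sqcup i}$ is the $i$-th shuffle power ($v^{\sqcup\!\sqcup 0}=\emptyset$). For $g$ a locally nilpotent endomorphism of a vector space $W$ (each $y\in W$ is killed by some power of $g$), $S(T(W,g))$ denotes the symmetric algebra of the vector space $T(W)$, with product $\times$ and unit $1\neq\emptyset$, with the following coproduct making it a Hopf algebra: $\Delta$ is the algebra morphism with $\Delta(w)=\tilde\Delta(w)+1\otimes w$ for $w\in T(W)$, where $\tilde\Delta:T(W)\to T(W)\otimes S(T(W,g))$ is defined by $\tilde\Delta(\emptyset)=\emptyset\otimes 1$ and, for $y\in W$, $w\in T(W)$, $$\tilde\Delta(yw)=\sum_{i\ge 0}(\theta_{g^i(y)}\otimes Id)\circ(Id\otimes m^{(i+1)})\circ(\tilde\Delta\otimes Id^{\otimes i})\circ\Delta^{(i+1)}_{\sqcup\!\sqcup}(w).$$ Here $\theta_z(w)=zw$; $m^{(j)}$ is the $j$-fold product of $S(T(W,g))$; $\Delta_{\sqcup\!\sqcup}$ is the coproduct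 dual to the shuffle product, i.e. the algebra morphism for concatenation with $\Delta_{\sqcup\!\sqcup}(y)=y\otimes\emptyset+\emptyset\otimes y$ for $y\in W$, and $\Delta^{(j)}_{\sqcup\!\sqcup}:T(W)\to T(W)^{\otimes j}$ is the iterated coproduct. A character is a unital algebra morphism $S(T(V^*,f^* ))\to\mathbb{K}$; the product of $G$ is convolution, $u\diamond v=(u\otimes v)\circ\Delta$. A character is determined by its restriction to $T(V^* )$, which can be any linear form, so $G$ is identified as a set with the set of linear forms on $T(V^* )$ (this gives the meaning of the sum "$+v$"). $\overline{T}(V)$ is embedded in $G$ through the pairing $\langle x_1\ldots x_n,y_1\ldots y_m\rangle=\delta_{m,n}\,y_1(x_1)\cdots y_n(x_n)$ for $x_i\in V$, $y_j\in V^*$. *)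

theory Defs
  imports
    "HOL-Analysis.Analysis"
    "HOL-Library.Poly_Mapping"
    "HOL-Library.Function_Algebras"
begin

hide_const (open) Poly_Mapping.range Poly_Mapping.degree Poly_Mapping.map Poly_Mapping.nth

text \<open>
  A vector space is given by a scalar multiplication on a type (locale \<^locale>\<open>vector_space\<close>), or is
  a subspace of such a space. If \<open>B\<close> is a basis of \<open>W\<close>, the words with letters in \<open>B\<close> form a basis
  of the tensor algebra \<open>T(W)\<close>, the finite multisets of such words form a basis of
  \<open>S(T(W))\<close> (the multiset \<open>{#w\<^sub>1, \<dots>, w\<^sub>n#}\<close> is the monomial \<open>w\<^sub>1 \<times> \<dots> \<times> w\<^sub>n\<close>), and pairs (or lists)
  of basis elements form a basis of a tensor product. All these spaces are therefore modelled by
  finitely supported functions on their basis, i.e. inside \<open>_ \<Rightarrow>\<^sub>0 'k\<close>; the product of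
  \<^typ>\<open>'w list multiset \<Rightarrow>\<^sub>0 'k\<close> is then the product \<open>\<times>\<close> of the symmetric algebra, and that of
  \<^typ>\<open>('w list multiset \<times> 'w list multiset) \<Rightarrow>\<^sub>0 'k\<close> the product of \<open>S(T(W)) \<otimes> S(T(W))\<close>.
  Letters which are not basis vectors are expanded in the basis.
\<close>

definition is_basis :: "('k::field \<Rightarrow> 'w::ab_group_add \<Rightarrow> 'w) \<Rightarrow> 'w set \<Rightarrow> 'w set \<Rightarrow> bool" where
  "is_basis s W B \<longleftrightarrow> \<not> module.dependent s B \<and> module.span s B = W"

lemma is_basis_exists:
  assumes "vector_space s" and "module.subspace s W"
  shows "\<exists>B. is_basis s W B"
proof -
  interpret vector_space s by fact
  obtain B where "B \<subseteq> W" "independent B" "W \<subseteq> span B"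
    using maximal_independent_subset by blast
  then show ?thesis
    using span_subspace[of B W] assms(2) by (auto simp: is_basis_def)
qed

definition locally_nilpotent_on :: "'w::zero set \<Rightarrow> ('w \<Rightarrow> 'w) \<Rightarrow> bool" where
  "locally_nilpotent_on W g \<longleftrightarrow> (\<forall>y\<in>W. \<exists>n. (g ^^ n) y = 0)"

definition fun_scale :: "'k::field \<Rightarrow> ('a \<Rightarrow> 'k) \<Rightarrow> 'a \<Rightarrow> 'k" where
  "fun_scale c h = (\<lambda>x. c * h x)"

lemma vector_space_fun_scale: "vector_space fun_scale"
  by unfold_locales (auto simp: fun_scale_def fun_eq_iff algebra_simps)

definition dual_space :: "('k::field \<Rightarrow> 'v::ab_group_add \<Rightarrow> 'v) \<Rightarrow> ('v \<Rightarrow> 'k) set" where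
  "dual_space s = {\<phi>. Vector_Spaces.linear s (*) \<phi>}"

definition transpose_map :: "('v \<Rightarrow> 'v) \<Rightarrow> ('v \<Rightarrow> 'k) \<Rightarrow> ('v \<Rightarrow> 'k)" where
  "transpose_map f \<phi> = \<phi> \<circ> f"


lemma subspace_dual_space:
  assumes "vector_space s"
  shows "module.subspace fun_scale (dual_space s)"
proof -
  interpret F: vector_space fun_scale by (rule vector_space_fun_scale)
  show ?thesis
    using assms unfolding F.subspace_def dual_space_def
    by (auto simp: Vector_Spaces.linear_iff vector_space_over_itself.vector_space_axioms
        fun_scale_def algebra_simps)
qed


section \<open>Free vector spaces\<close>

abbreviation basis_vec :: "'a \<Rightarrow> 'a \<Rightarrow>\<^sub>0 'k::zero_neq_one" where
  "basis_vec a \<equiv> Poly_Mapping.single a 1"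

definition scale_pm :: "'k \<Rightarrow> ('a \<Rightarrow>\<^sub>0 'k) \<Rightarrow> 'a \<Rightarrow>\<^sub>0 'k::field" where
  "scale_pm c p = Poly_Mapping.map ((*) c) p"

text \<open>The linear extension of a map given on basis elements.\<close>

definition lin_ext :: "('a \<Rightarrow> 'b \<Rightarrow>\<^sub>0 'k) \<Rightarrow> ('a \<Rightarrow>\<^sub>0 'k) \<Rightarrow> 'b \<Rightarrow>\<^sub>0 'k::field" where
  "lin_ext \<phi> p = (\<Sum>a\<in>Poly_Mapping.keys p. scale_pm (Poly_Mapping.lookup p a) (\<phi> a))"

lemma lin_ext_cong [fundef_cong]:
  assumes "p = q" and "\<And>a. a \<in> Poly_Mapping.keys q \<Longrightarrow> \<phi> a = \<psi> a"
  shows "lin_ext \<phi> p = lin_ext \<psi> q"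
  unfolding lin_ext_def using assms by (intro sum.cong) auto

definition tensor_pm :: "('a \<Rightarrow>\<^sub>0 'k) \<Rightarrow> ('b \<Rightarrow>\<^sub>0 'k) \<Rightarrow> ('a \<times> 'b) \<Rightarrow>\<^sub>0 'k::field" where
  "tensor_pm p q = lin_ext (\<lambda>a. lin_ext (\<lambda>b. basis_vec (a, b)) q) p"


section \<open>The algebra \<open>S(T(W, g))\<close> and its coproduct\<close>

definition tensor_alg :: "'w set \<Rightarrow> ('w list \<Rightarrow>\<^sub>0 'k::field) set" where
  "tensor_alg B = {p. Poly_Mapping.keys p \<subseteq> lists B}"

definition sym_alg :: "'w set \<Rightarrow> ('w list multiset \<Rightarrow>\<^sub>0 'k::field) set" where
  "sym_alg B = {P. \<forall>M\<in>Poly_Mapping.keys P. set_mset M \<subseteq> lists B}"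

definition tensor_incl :: "('w list \<Rightarrow>\<^sub>0 'k) \<Rightarrow> 'w list multiset \<Rightarrow>\<^sub>0 'k::field" where
  "tensor_incl = lin_ext (\<lambda>w. basis_vec {#w#})"

text \<open>\<open>\<Delta>\<close> for the shuffle structure: \<open>\<Delta>(yw) = (y \<otimes> \<emptyset> + \<emptyset> \<otimes> y) \<Delta>(w)\<close>, on words.\<close>

primrec unshuffle :: "'w list \<Rightarrow> ('w list \<times> 'w list) \<Rightarrow>\<^sub>0 'k::field" where
  "unshuffle [] = basis_vec ([], [])"
| "unshuffle (y # w) =
     lin_ext (\<lambda>(a, b). basis_vec (y # a, b) + basis_vec (a, y # b)) (unshuffle w)"

text \<open>\<open>iter_unshuffle i\<close> is \<open>\<Delta>\<^sup>(\<^sup>i\<^sup>+\<^sup>1\<^sup>)\<close>, with values in \<open>T(W)\<^sup>\<otimes>\<^sup>(\<^sup>i\<^sup>+\<^sup>1\<^sup>)\<close>: pure tensors of words are lists of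
  length \<open>i + 1\<close>.\<close>

primrec iter_unshuffle :: "nat \<Rightarrow> 'w list \<Rightarrow> 'w list list \<Rightarrow>\<^sub>0 'k::field" where
  "iter_unshuffle 0 w = basis_vec [w]"
| "iter_unshuffle (Suc i) w =
     lin_ext (\<lambda>(a, b). lin_ext (\<lambda>us. basis_vec (a # us)) (iter_unshuffle i b)) (unshuffle w)"

text \<open>\<open>\<theta>\<^sub>z(w) = zw\<close>, for a basis word \<open>w\<close> and an arbitrary vector \<open>z\<close> of the span of \<open>B\<close>.\<close>

definition theta ::
    "('k::field \<Rightarrow> 'w::ab_group_add \<Rightarrow> 'w) \<Rightarrow> 'w set \<Rightarrow> 'w \<Rightarrow> 'w list \<Rightarrow> 'w list \<Rightarrow>\<^sub>0 'k" where
  "theta s B z w =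
     (\<Sum>b | module.representation s B z b \<noteq> 0.
        Poly_Mapping.single (b # w) (module.representation s B z b))"

lemma keys_scale_pm: "Poly_Mapping.keys (scale_pm c p) \<subseteq> Poly_Mapping.keys p"
  by (auto simp: scale_pm_def in_keys_iff map.rep_eq when_def split: if_splits)

lemma keys_lin_ext:
  "Poly_Mapping.keys (lin_ext \<phi> p) \<subseteq> (\<Union>a\<in>Poly_Mapping.keys p. Poly_Mapping.keys (\<phi> a))"
proof
  fix x assume "x \<in> Poly_Mapping.keys (lin_ext \<phi> p)"
  then have "(\<Sum>a\<in>Poly_Mapping.keys p.
      Poly_Mapping.lookup (scale_pm (Poly_Mapping.lookup p a) (\<phi> a)) x) \<noteq> 0"
    by (simp add: lin_ext_def in_keys_iff lookup_sum)
  then obtain a where "a \<in> Poly_Mapping.keys p"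
      "Poly_Mapping.lookup (scale_pm (Poly_Mapping.lookup p a) (\<phi> a)) x \<noteq> 0"
    using sum.not_neutral_contains_not_neutral by blast
  then show "x \<in> (\<Union>a\<in>Poly_Mapping.keys p. Poly_Mapping.keys (\<phi> a))"
    using keys_scale_pm by (fastforce simp: in_keys_iff)
qed

lemma keys_unshuffle:
  "x \<in> Poly_Mapping.keys (unshuffle w :: _ \<Rightarrow>\<^sub>0 'k::field) \<Longrightarrow>
     length (fst x) + length (snd x) = length w"
proof (induction w arbitrary: x)
  case (Cons y w)
  from Cons.prems obtain a b where ab: "(a, b) \<in> Poly_Mapping.keys (unshuffle w :: _ \<Rightarrow>\<^sub>0 'k)"
    and x: "x \<in> Poly_Mapping.keys (basis_vec (y # a, b) + basis_vec (a, y # b) :: _ \<Rightarrow>\<^sub>0 'k)"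
    using keys_lin_ext by fastforce
  from x have "x = (y # a, b) \<or> x = (a, y # b)"
    using keys_add by fastforce
  with Cons.IH[OF ab] show ?case by auto
qed simp

lemma keys_iter_unshuffle:
  "us \<in> Poly_Mapping.keys (iter_unshuffle i w :: _ \<Rightarrow>\<^sub>0 'k::field) \<Longrightarrow>
     length us = Suc i \<and> (\<forall>u\<in>set us. length u \<le> length w)"
proof (induction i arbitrary: w us)
  case (Suc i)
  from Suc.prems obtain ab where
      ab: "ab \<in> Poly_Mapping.keys (unshuffle w :: _ \<Rightarrow>\<^sub>0 'k)"
    and "us \<in> Poly_Mapping.keys
      (lin_ext (\<lambda>us. basis_vec (fst ab # us)) (iter_unshuffle i (snd ab)) :: _ \<Rightarrow>\<^sub>0 'k)"
    using keys_lin_ext by (fastforce simp: case_prod_unfold)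
  then obtain vs where
      vs: "vs \<in> Poly_Mapping.keys (iter_unshuffle i (snd ab) :: _ \<Rightarrow>\<^sub>0 'k)"
    and us: "us = fst ab # vs"
    using keys_lin_ext by fastforce
  from keys_unshuffle[OF ab] have "length (fst ab) \<le> length w" "length (snd ab) \<le> length w" by auto
  with Suc.IH[OF vs] us show ?case by auto
qed simp

text \<open>
  The map \<open>\<Delta>\<close>-tilde from \<open>T(W)\<close> to \<open>T(W) \<otimes> S(T(W, g))\<close>, on words in the basis. From the inside
  to the outside, the three linear extensions are \<open>\<Delta>\<close>-tilde \<open>\<otimes> Id\<^sup>\<otimes>\<^sup>i\<close>, \<open>Id \<otimes> m\<^sup>(\<^sup>i\<^sup>+\<^sup>1\<^sup>)\<close> and
  \<open>\<theta> \<otimes> Id\<close>. The sum over \<open>i\<close> has finitely many nonzero terms if \<open>g\<close> is locally nilpotent.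
  The equation is linear in the first letter \<open>y\<close>, and so it is enough to state it for \<open>y \<in> B\<close>.
\<close>

function delta_tilde ::
    "('k::field \<Rightarrow> 'w::ab_group_add \<Rightarrow> 'w) \<Rightarrow> 'w set \<Rightarrow> ('w \<Rightarrow> 'w) \<Rightarrow> 'w list
       \<Rightarrow> ('w list \<times> 'w list multiset) \<Rightarrow>\<^sub>0 'k" where
  "delta_tilde s B g [] = basis_vec ([], 0)"
| "delta_tilde s B g (y # w) =
     Sum_any (\<lambda>i.
       lin_ext (\<lambda>(a, M). tensor_pm (theta s B ((g ^^ i) y) a) (basis_vec M))
         (lin_ext (\<lambda>((a, M), us). basis_vec (a, M + mset us))
            (lin_ext (\<lambda>ws. tensor_pm (delta_tilde s B g (hd ws)) (basis_vec (tl ws)))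
               (iter_unshuffle i w))))"
  by pat_completeness auto
termination
proof (relation "Wellfounded.measure (\<lambda>(s, B, g, w). length w)", goal_cases)
  case (2 s B g y w i ws)
  then have "ws \<noteq> []" "\<forall>u\<in>set ws. length u \<le> length w"
    using keys_iter_unshuffle by fastforce+
  then show ?case by (auto simp: less_Suc_eq_le)
qed auto

text \<open>As claimed above, the recursive equation holds for every \<open>y \<in> W\<close>, not only for \<open>y \<in> B\<close>.\<close>

lemma lookup_scale_pm [simp]: "Poly_Mapping.lookup (scale_pm c p) x = c * Poly_Mapping.lookup p x"
  by (simp add: scale_pm_def map.rep_eq when_def)

lemma lookup_lin_ext:
  assumes "finite A" and "Poly_Mapping.keys p \<subseteq> A"
  shows "Poly_Mapping.lookup (lin_ext \<phi> p) x =
    (\<Sum>a\<in>A. Poly_Mapping.lookup p a * Poly_Mapping.lookup (\<phi> a) x)"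
  unfolding lin_ext_def lookup_sum lookup_scale_pm using assms
  by (intro sum.mono_neutral_left) (auto simp: in_keys_iff)

lemma lin_ext_basis_vec [simp]: "lin_ext \<phi> (basis_vec a) = \<phi> a"
  by (rule poly_mapping_eqI) (simp add: lookup_lin_ext[of "{a}"])

lemma lookup_theta:
  assumes "vector_space s"
  shows "Poly_Mapping.lookup (theta s B z w) x =
    (case x of [] \<Rightarrow> 0 | b # w' \<Rightarrow> module.representation s B z b when w' = w)"
proof -
  interpret vector_space s by fact
  have fin: "finite {b. representation B z b \<noteq> 0}" by (rule finite_representation)
  have "Poly_Mapping.lookup (theta s B z w) x =
      (\<Sum>b | representation B z b \<noteq> 0. representation B z b when b # w = x)"
    by (simp add: theta_def lookup_sum lookup_single)
  also have "\<dots> = (case x of [] \<Rightarrow> 0 | b # w' \<Rightarrow> representation B z b when w' = w)"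
  proof (cases x)
    case (Cons c w')
    have "(\<Sum>b | representation B z b \<noteq> 0. representation B z b when b # w = x) =
        (\<Sum>b | representation B z b \<noteq> 0. if c = b then representation B z b when w' = w else 0)"
      by (intro sum.cong) (auto simp: Cons when_def)
    then show ?thesis using fin by (simp add: Cons sum.delta')
  qed simp
  finally show ?thesis .
qed

lemma lookup_tensor_basis_vec:
  fixes p :: "'a \<Rightarrow>\<^sub>0 'c::field"
  shows "Poly_Mapping.lookup (tensor_pm p (basis_vec M)) q = (Poly_Mapping.lookup p (fst q) when M = snd q)"
proof -
  obtain a N where q: "q = (a, N)" by (cases q)
  have "Poly_Mapping.lookup (tensor_pm p (basis_vec M)) q =
      (\<Sum>c\<in>insert a (Poly_Mapping.keys p). Poly_Mapping.lookup p c *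
         Poly_Mapping.lookup (basis_vec (c, M) :: _ \<Rightarrow>\<^sub>0 'c) q)"
    unfolding tensor_pm_def lin_ext_basis_vec by (rule lookup_lin_ext) auto
  also have "\<dots> = (\<Sum>c\<in>insert a (Poly_Mapping.keys p).
         if a = c then Poly_Mapping.lookup p a when M = N else 0)"
    by (intro sum.cong) (auto simp: q lookup_single when_def)
  finally have "Poly_Mapping.lookup (tensor_pm p (basis_vec M)) q = \<dots>" .
  then show ?thesis by (simp add: q sum.delta')
qed

lemma delta_tilde_letter:
  assumes vs: "vector_space s" and basis: "is_basis s W B" and "locally_nilpotent_on W g"
    and closed: "\<And>y. y \<in> W \<Longrightarrow> g y \<in> W"
    and add: "\<And>y z. y \<in> W \<Longrightarrow> z \<in> W \<Longrightarrow> g (y + z) = g y + g z"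
    and scale: "\<And>c y. y \<in> W \<Longrightarrow> g (s c y) = s c (g y)"
    and y: "y \<in> W"
  shows "lin_ext (delta_tilde s B g) (theta s B y w) =
     Sum_any (\<lambda>i.
       lin_ext (\<lambda>(a, M). tensor_pm (theta s B ((g ^^ i) y) a) (basis_vec M))
         (lin_ext (\<lambda>((a, M), us). basis_vec (a, M + mset us))
            (lin_ext (\<lambda>ws. tensor_pm (delta_tilde s B g (hd ws)) (basis_vec (tl ws)))
               (iter_unshuffle i w))))"
proof -
  interpret vector_space s by fact
  from basis have ind: "independent B" and span: "span B = W" by (auto simp: is_basis_def)
  have BW: "b \<in> W" if "b \<in> B" for b using that span span_base by auto
  define R where "R = (\<lambda>y. representation B y)"
  define S where "S = {b. R y b \<noteq> 0}"
  have finS: "finite S" by (simp add: S_def R_def finite_representation)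
  have SW: "b \<in> W" if "b \<in> S" for b
    using that representation_ne_zero BW by (auto simp: S_def R_def)
  define Y where "Y = (\<lambda>i. lin_ext (\<lambda>((a, M), us). basis_vec (a, M + mset us))
            (lin_ext (\<lambda>ws. tensor_pm (delta_tilde s B g (hd ws)) (basis_vec (tl ws)))
               (iter_unshuffle i w)))"
  define F where "F = (\<lambda>z i. lin_ext (\<lambda>(a, M). tensor_pm (theta s B z a) (basis_vec M)) (Y i))"
  have gW: "(g ^^ i) z \<in> W" if "z \<in> W" for i z using that closed by (induction i) auto
  have gadd: "(g ^^ i) (z + z') = (g ^^ i) z + (g ^^ i) z'" if "z \<in> W" "z' \<in> W" for i z z'
    using that add gW by (induction i) auto
  have gscale: "(g ^^ i) (s c z) = s c ((g ^^ i) z)" if "z \<in> W" for i c z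
    using that scale gW by (induction i) auto
  have "0 \<in> W" using span span_zero by auto
  then have gzero: "(g ^^ i) 0 = 0" for i using gscale[of 0 i 0] by simp
  have gsum: "(g ^^ i) (\<Sum>b\<in>A. s (c b) b) = (\<Sum>b\<in>A. s (c b) ((g ^^ i) b))"
    if "finite A" "A \<subseteq> W" for A c i
    using that
  proof (induction rule: finite_induct)
    case (insert b A)
    have "s (c b) b \<in> W" "(\<Sum>b\<in>A. s (c b) b) \<in> W"
      using insert.prems span by (auto intro!: span_scale span_sum)
    then show ?case using insert by (simp add: gadd gscale)
  qed (simp add: gzero)
  have Rg: "R ((g ^^ i) y) c = (\<Sum>b\<in>S. R y b * R ((g ^^ i) b) c)" for i c
  proof -
    have "y = (\<Sum>b\<in>S. s (R y b) b)"
      using sum_nonzero_representation_eq[OF ind] y span by (simp add: S_def R_def)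
    then have "(g ^^ i) y = (\<Sum>b\<in>S. s (R y b) ((g ^^ i) b))"
      using gsum[OF finS, where c = "R y" and i = i] SW by auto
    then have "R ((g ^^ i) y) = R (\<Sum>b\<in>S. s (R y b) ((g ^^ i) b))" by simp
    also have "\<dots> = (\<lambda>c. \<Sum>b\<in>S. R (s (R y b) ((g ^^ i) b)) c)"
      using gW SW span unfolding R_def by (intro representation_sum[OF ind]) (auto intro!: span_scale)
    also have "\<dots> = (\<lambda>c. \<Sum>b\<in>S. R y b * R ((g ^^ i) b) c)"
      using gW SW span by (auto simp: R_def representation_scale[OF ind] intro!: sum.cong)
    finally show ?thesis by simp
  qed
  have "\<exists>n. \<forall>z\<in>insert y S. (g ^^ n) z = 0"
  proof -
    from assms(3) have "\<forall>z\<in>insert y S. \<exists>n. (g ^^ n) z = 0"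
      using y SW by (auto simp: locally_nilpotent_on_def)
    then obtain n where n: "\<And>z. z \<in> insert y S \<Longrightarrow> (g ^^ n z) z = 0" by metis
    have "(g ^^ Max (n ` insert y S)) z = 0" if "z \<in> insert y S" for z
    proof -
      have "n z \<le> Max (n ` insert y S)" using finS that by (intro Max_ge) auto
      then obtain k where "Max (n ` insert y S) = k + n z" by (metis add.commute le_Suc_ex)
      then show ?thesis using n[OF that] gzero by (simp add: funpow_add)
    qed
    then show ?thesis by blast
  qed
  then obtain n where n: "\<And>z. z \<in> insert y S \<Longrightarrow> (g ^^ n) z = 0" by blast
  have g0: "(g ^^ i) z = 0" if "z \<in> insert y S" "n \<le> i" for z i
  proof -
    from that(2) obtain k where "i = k + n" by (metis add.commute le_Suc_ex)
    then show ?thesis using n[OF that(1)] gzero by (simp add: funpow_add)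
  qed
  have lookF: "Poly_Mapping.lookup (F z i) q = (\<Sum>k\<in>Poly_Mapping.keys (Y i).
      Poly_Mapping.lookup (Y i) k *
        (case fst q of [] \<Rightarrow> 0 | b # w' \<Rightarrow> R z b when w' = fst k \<and> snd k = snd q))" for z i q
    unfolding F_def
    by (subst lookup_lin_ext[OF _ order_refl])
      (auto simp: lookup_tensor_basis_vec lookup_theta[OF vs] R_def when_def split: list.split
        intro!: sum.cong)
  have F0: "F 0 i = 0" for i
  proof (rule poly_mapping_eqI)
    fix q
    show "Poly_Mapping.lookup (F 0 i) q = Poly_Mapping.lookup 0 q"
      by (cases "fst q") (simp_all add: lookF R_def representation_zero)
  qed
  have any: "Sum_any (\<lambda>i. F ((g ^^ i) z) i) = (\<Sum>i<n. F ((g ^^ i) z) i)" if "z \<in> insert y S" for z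
  proof (rule Sum_any.expand_superset)
    show "{i. F ((g ^^ i) z) i \<noteq> 0} \<subseteq> {..<n}"
    proof
      fix i assume "i \<in> {i. F ((g ^^ i) z) i \<noteq> 0}"
      then show "i \<in> {..<n}" using g0[OF that, of i] F0 by (cases "n \<le> i") auto
    qed
  qed simp
  have FS: "Poly_Mapping.lookup (F ((g ^^ i) y) i) q =
      (\<Sum>b\<in>S. R y b * Poly_Mapping.lookup (F ((g ^^ i) b) i) q)" for i q
  proof (cases "fst q")
    case (Cons c w')
    have "Poly_Mapping.lookup (F ((g ^^ i) y) i) q = (\<Sum>k\<in>Poly_Mapping.keys (Y i).
        \<Sum>b\<in>S. R y b * (Poly_Mapping.lookup (Y i) k *
          (R ((g ^^ i) b) c when w' = fst k \<and> snd k = snd q)))"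
      unfolding lookF Cons list.case Rg
      by (intro sum.cong refl, rename_tac k, case_tac "w' = fst k \<and> snd k = snd q")
        (auto simp: sum_distrib_left mult_ac)
    also have "\<dots> = (\<Sum>b\<in>S. R y b * Poly_Mapping.lookup (F ((g ^^ i) b) i) q)"
      by (subst sum.swap) (simp add: lookF Cons sum_distrib_left)
    finally show ?thesis .
  qed (simp add: lookF)
  have "lin_ext (delta_tilde s B g) (theta s B y w) = Sum_any (\<lambda>i. F ((g ^^ i) y) i)"
  proof (rule poly_mapping_eqI)
    fix q
    have keys: "Poly_Mapping.keys (theta s B y w) \<subseteq> (\<lambda>b. b # w) ` S"
      by (auto simp: in_keys_iff lookup_theta[OF vs] S_def R_def when_def
          split: list.splits if_splits)
    have "Poly_Mapping.lookup (lin_ext (delta_tilde s B g) (theta s B y w)) q =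
        (\<Sum>b\<in>S. R y b * Poly_Mapping.lookup (delta_tilde s B g (b # w)) q)"
      by (subst lookup_lin_ext[OF _ keys])
        (auto simp: finS sum.reindex inj_on_def lookup_theta[OF vs] R_def)
    also have "\<dots> = (\<Sum>b\<in>S. R y b * (\<Sum>i<n. Poly_Mapping.lookup (F ((g ^^ i) b) i) q))"
    proof (intro sum.cong refl)
      fix b assume "b \<in> S"
      have "delta_tilde s B g (b # w) = Sum_any (\<lambda>i. F ((g ^^ i) b) i)"
        by (simp add: F_def Y_def)
      with any[of b] \<open>b \<in> S\<close>
      show "R y b * Poly_Mapping.lookup (delta_tilde s B g (b # w)) q =
          R y b * (\<Sum>i<n. Poly_Mapping.lookup (F ((g ^^ i) b) i) q)"
        by (simp add: lookup_sum)
    qed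
    also have "\<dots> = (\<Sum>i<n. Poly_Mapping.lookup (F ((g ^^ i) y) i) q)"
      unfolding FS sum_distrib_left by (rule sum.swap)
    also have "\<dots> = Poly_Mapping.lookup (Sum_any (\<lambda>i. F ((g ^^ i) y) i)) q"
      by (simp add: any lookup_sum)
    finally show "Poly_Mapping.lookup (lin_ext (delta_tilde s B g) (theta s B y w)) q =
        Poly_Mapping.lookup (Sum_any (\<lambda>i. F ((g ^^ i) y) i)) q" .
  qed
  then show ?thesis by (simp add: F_def Y_def)
qed

text \<open>\<open>\<Delta>(w) = \<Delta>\<close>-tilde\<open>(w) + 1 \<otimes> w\<close> on the generators \<open>w\<close>, extended to an algebra morphism.\<close>

definition coprod_word ::
    "('k::field \<Rightarrow> 'w::ab_group_add \<Rightarrow> 'w) \<Rightarrow> 'w set \<Rightarrow> ('w \<Rightarrow> 'w) \<Rightarrow> 'w list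
       \<Rightarrow> ('w list multiset \<times> 'w list multiset) \<Rightarrow>\<^sub>0 'k" where
  "coprod_word s B g w =
     lin_ext (\<lambda>(a, M). basis_vec ({#a#}, M)) (delta_tilde s B g w) + basis_vec (0, {#w#})"

definition coprod ::
    "('k::field \<Rightarrow> 'w::ab_group_add \<Rightarrow> 'w) \<Rightarrow> 'w set \<Rightarrow> ('w \<Rightarrow> 'w) \<Rightarrow> ('w list multiset \<Rightarrow>\<^sub>0 'k)
       \<Rightarrow> ('w list multiset \<times> 'w list multiset) \<Rightarrow>\<^sub>0 'k" where
  "coprod s B g = lin_ext (\<lambda>M. \<Prod>w\<in>#M. coprod_word s B g w)"


section \<open>Characters\<close>

text \<open>Characters are extensional functions, so that two of them are equal iff they agree on
  \<open>S(T(W))\<close>.\<close>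

definition characters :: "'w set \<Rightarrow> (('w list multiset \<Rightarrow>\<^sub>0 'k::field) \<Rightarrow> 'k) set" where
  "characters B = {h \<in> extensional (sym_alg B).
     h 1 = 1 \<and>
     (\<forall>P\<in>sym_alg B. \<forall>Q\<in>sym_alg B. h (P + Q) = h P + h Q \<and> h (P * Q) = h P * h Q) \<and>
     (\<forall>c. \<forall>P\<in>sym_alg B. h (scale_pm c P) = c * h P)}"

text \<open>The convolution product \<open>\<mu> \<diamond> \<nu> = (\<mu> \<otimes> \<nu>) \<circ> \<Delta>\<close>.\<close>

definition tensor_form ::
    "(('a \<Rightarrow>\<^sub>0 'k) \<Rightarrow> 'k) \<Rightarrow> (('b \<Rightarrow>\<^sub>0 'k) \<Rightarrow> 'k) \<Rightarrow> (('a \<times> 'b) \<Rightarrow>\<^sub>0 'k) \<Rightarrow> 'k::field" where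
  "tensor_form \<mu> \<nu> Z =
     (\<Sum>(M, N)\<in>Poly_Mapping.keys Z.
        Poly_Mapping.lookup Z (M, N) * (\<mu> (basis_vec M) * \<nu> (basis_vec N)))"

definition convolution ::
    "('k::field \<Rightarrow> 'w::ab_group_add \<Rightarrow> 'w) \<Rightarrow> 'w set \<Rightarrow> ('w \<Rightarrow> 'w)
       \<Rightarrow> (('w list multiset \<Rightarrow>\<^sub>0 'k) \<Rightarrow> 'k) \<Rightarrow> (('w list multiset \<Rightarrow>\<^sub>0 'k) \<Rightarrow> 'k)
       \<Rightarrow> ('w list multiset \<Rightarrow>\<^sub>0 'k) \<Rightarrow> 'k" where
  "convolution s B g \<mu> \<nu> = restrict (tensor_form \<mu> \<nu> \<circ> coprod s B g) (sym_alg B)"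

text \<open>The identification of linear forms on \<open>T(W)\<close> with characters.\<close>

definition char_of_form ::
    "'w set \<Rightarrow> (('w list \<Rightarrow>\<^sub>0 'k::field) \<Rightarrow> 'k) \<Rightarrow> ('w list multiset \<Rightarrow>\<^sub>0 'k) \<Rightarrow> 'k" where
  "char_of_form B l =
     (THE h. h \<in> characters B \<and> (\<forall>p\<in>tensor_alg B. h (tensor_incl p) = l p))"


section \<open>The completed tensor algebra\<close>

text \<open>Elements of \<open>\<Prod>\<^sub>n V\<^sup>\<otimes>\<^sup>n\<close> are infinite sums of words in a basis \<open>B\<close> of \<open>V\<close>, with finitely many words of
  each length.\<close>

definition completed_tensor_alg :: "'v set \<Rightarrow> ('v list \<Rightarrow> 'k::field) set" where
  "completed_tensor_alg B =
     {t. {w. t w \<noteq> 0} \<subseteq> lists B \<and> (\<forall>n. finite {w. length w = n \<and> t w \<noteq> 0})}"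

definition word_dist :: "('v list \<Rightarrow> 'k) \<Rightarrow> ('v list \<Rightarrow> 'k) \<Rightarrow> real" where
  "word_dist t t' =
     (if t = t' then 0 else (1 / 2) ^ (LEAST n. \<exists>w. length w = n \<and> t w \<noteq> t' w))"

lemma word_dist_less_iff:
  "word_dist t t' < (1 / 2) ^ n \<longleftrightarrow> (\<forall>w. length w \<le> n \<longrightarrow> t w = t' w)"
proof (cases "t = t'")
  case False
  define P where "P = (\<lambda>n. \<exists>w. length w = n \<and> t w \<noteq> t' w)"
  from False obtain w where "t w \<noteq> t' w" by auto
  then have "P (length w)" by (auto simp: P_def)
  then have L: "P (Least P)" by (rule LeastI)
  have "word_dist t t' < (1 / 2) ^ n \<longleftrightarrow> (1 / 2 :: real) ^ Least P < (1 / 2) ^ n"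
    using False by (simp add: word_dist_def P_def)
  also have "\<dots> \<longleftrightarrow> n < Least P"
    by (rule power_strict_decreasing_iff) auto
  also have "\<dots> \<longleftrightarrow> (\<forall>m\<le>n. \<not> P m)"
    using L not_less_Least[of _ P] by (meson le_less_trans not_le)
  finally show ?thesis by (auto simp: P_def)
qed (simp add: word_dist_def)

lemma Metric_space_word_dist: "Metric_space A word_dist"
proof
  fix t t' t'' :: "'a list \<Rightarrow> 'b"
  show "0 \<le> word_dist t t'" by (simp add: word_dist_def)
  have "(\<lambda>n. \<exists>w. length w = n \<and> t w \<noteq> t' w) = (\<lambda>n. \<exists>w. length w = n \<and> t' w \<noteq> t w)"
    by (intro ext) auto
  then show "word_dist t t' = word_dist t' t" by (auto simp: word_dist_def)
  show "word_dist t t' = 0 \<longleftrightarrow> t = t'" by (simp add: word_dist_def)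
  show "word_dist t t'' \<le> word_dist t t' + word_dist t' t''"
  proof (cases "t = t''")
    case False
    define n where "n = (LEAST n. \<exists>w. length w = n \<and> t w \<noteq> t'' w)"
    have n: "word_dist t t'' = (1 / 2) ^ n" using False by (simp add: word_dist_def n_def)
    then have "\<not> (word_dist t t' < (1 / 2) ^ n \<and> word_dist t' t'' < (1 / 2) ^ n)"
      using word_dist_less_iff[of t t' n] word_dist_less_iff[of t' t'' n]
        word_dist_less_iff[of t t'' n] by auto
    moreover have "0 \<le> word_dist t t'" "0 \<le> word_dist t' t''" by (simp_all add: word_dist_def)
    ultimately show ?thesis using n by linarith
  qed (simp add: word_dist_def)
qed

definition tensor_topology :: "'v set \<Rightarrow> ('v list \<Rightarrow> 'k::field) topology" where
  "tensor_topology B = Metric_space.mtopology (completed_tensor_alg B) word_dist"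

definition empty_word :: "'v list \<Rightarrow> 'k::field" where
  "empty_word = (\<lambda>w. if w = [] then 1 else 0)"

text \<open>The concatenation \<open>xu\<close> for an arbitrary vector \<open>x\<close>.\<close>

definition letter_conc ::
    "('k::field \<Rightarrow> 'v::ab_group_add \<Rightarrow> 'v) \<Rightarrow> 'v set \<Rightarrow> 'v \<Rightarrow> ('v list \<Rightarrow> 'k) \<Rightarrow> 'v list \<Rightarrow> 'k" where
  "letter_conc s B x u =
     (\<lambda>w. case w of [] \<Rightarrow> 0 | b # w' \<Rightarrow> module.representation s B x b * u w')"

text \<open>The library function \<^const>\<open>shuffles\<close> forgets multiplicities.\<close>

fun shuffle_words :: "'v list \<Rightarrow> 'v list \<Rightarrow> 'v list multiset" where
  "shuffle_words [] v = {#v#}"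
| "shuffle_words u [] = {#u#}"
| "shuffle_words (x # u) (y # v) =
     image_mset ((#) x) (shuffle_words u (y # v)) + image_mset ((#) y) (shuffle_words (x # u) v)"

definition shuffle :: "('v list \<Rightarrow> 'k::field) \<Rightarrow> ('v list \<Rightarrow> 'k) \<Rightarrow> 'v list \<Rightarrow> 'k" where
  "shuffle u v =
     (\<lambda>w. \<Sum>(a, b) | w \<in># shuffle_words a b. of_nat (count (shuffle_words a b) w) * (u a * v b))"

definition shuffle_power :: "('v list \<Rightarrow> 'k::field) \<Rightarrow> nat \<Rightarrow> 'v list \<Rightarrow> 'k" where
  "shuffle_power v i = (shuffle v ^^ i) empty_word"

text \<open>The pairing of \<open>\<Prod>\<^sub>n V\<^sup>\<otimes>\<^sup>n\<close> with \<open>T(V\<^sup>*)\<close>; here the letters of \<open>y\<close> are linear forms on \<open>V\<close>.\<close>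

definition pairing :: "('v list \<Rightarrow> 'k::field) \<Rightarrow> (('v \<Rightarrow> 'k) list \<Rightarrow>\<^sub>0 'k) \<Rightarrow> 'k" where
  "pairing t p =
     (\<Sum>y\<in>Poly_Mapping.keys p. Poly_Mapping.lookup p y *
        (\<Sum>x | length x = length y \<and> t x \<noteq> 0. t x * (\<Prod>i<length y. (y ! i) (x ! i))))"

text \<open>The requirements defining \<open>\<diamond>\<close>-tilde; the sum over \<open>i\<close> is the limit of its partial sums in the
  ultrametric topology.\<close>

definition is_tilde_comp ::
    "('k::field \<Rightarrow> 'v::ab_group_add \<Rightarrow> 'v) \<Rightarrow> 'v set \<Rightarrow> ('v \<Rightarrow> 'v)
       \<Rightarrow> (('v list \<Rightarrow> 'k) \<Rightarrow> ('v list \<Rightarrow> 'k) \<Rightarrow> ('v list \<Rightarrow> 'k)) \<Rightarrow> bool" where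
  "is_tilde_comp s B f cmp \<longleftrightarrow>
     (\<forall>u\<in>completed_tensor_alg B. \<forall>v\<in>completed_tensor_alg B. cmp u v \<in> completed_tensor_alg B) \<and>
     (\<forall>v\<in>completed_tensor_alg B.
        (\<forall>u\<in>completed_tensor_alg B. \<forall>u'\<in>completed_tensor_alg B.
           cmp (u + u') v = cmp u v + cmp u' v) \<and>
        (\<forall>c. \<forall>u\<in>completed_tensor_alg B. cmp (fun_scale c u) v = fun_scale c (cmp u v)) \<and>
        continuous_map (tensor_topology B) (tensor_topology B) (\<lambda>u. cmp u v) \<and>
        cmp empty_word v = empty_word \<and>
        (\<forall>x. \<forall>u\<in>completed_tensor_alg B.
           limitin (tensor_topology B)
             (\<lambda>n. \<Sum>i<n. letter_conc s B ((f ^^ i) x) (shuffle (cmp u v) (shuffle_power v i)))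
             (cmp (letter_conc s B x u) v) sequentially))"

end

theory Submission
  imports Defs
begin

text \<open>
  A character is the multiplicative extension of its values on words, so the identity only has to
  be checked on each word \<open>y\<close> with letters in \<open>V\<^sup>*\<close>. There \<open>\<Delta>(y) = \<Delta>\<close>-tilde\<open>(y) + 1 \<otimes> y\<close>; the second
  summand contributes \<open>\<langle>v, y\<rangle>\<close>, and what is left is the statement that \<open>\<diamond>\<close>-tilde is dual to
  \<open>\<Delta>\<close>-tilde: \<open>\<langle>u \<diamond>\<close>-tilde\<open> v, y\<rangle> = (u \<otimes> v)(\<Delta>\<close>-tilde\<open>(y))\<close>, where \<open>v\<close> acts on the second factor
  multiplicatively (lemma \<open>pairing_cmp\<close>).

  Both sides of this equation are linear in \<open>u\<close> and depend on finitely many homogeneous components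
  of \<open>u\<close> only, the left one by continuity and the right one since \<open>\<Delta>\<close>-tilde\<open>(y)\<close> is a finite sum. So \<open>u\<close>
  may be taken to be a word, and induction on this word works because the two recursions
  mirror each other (\<open>pairing_cmp_word\<close>). For \<open>u = xw\<close> and \<open>y = zy'\<close>, the \<open>i\<close>-th term on the left
  pairs to \<open>z(f\<^sup>i(x))\<close> times the pairing of the shuffle of \<open>w \<diamond>\<close>-tilde\<open> v\<close> and \<open>v\<^sup>i\<close> with \<open>y'\<close>. The \<open>i\<close>-th term
  on the right prepends the letter \<open>z \<circ> f\<^sup>i\<close>, which gives the same scalar. The remaining factors agree
  because the shuffle product is dual to the unshuffling coproduct (\<open>pairing_word_shuffle\<close>), and hence
  shuffling with an \<open>i\<close>-th power is dual to the iterated coproduct (\<open>pairing_word_iter_unshuffle\<close>).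

  The series over \<open>i\<close> need not converge by degree reasons alone, since \<open>v\<close> may have a constant
  term. What makes it converge is that local nilpotency of the transpose on the whole dual
  space forces \<open>f\<close> itself to be nilpotent (\<open>nilpotent_if_transpose_locally_nilpotent\<close>): the series
  is a finite sum. With \<open>f\<^sup>N = 0\<close> fixed, the composition is defined by recursion on words and
  extended to infinite sums of words, which is possible because composing a word with \<open>v\<close> never
  produces shorter words (\<open>tilde_word_length\<close>).
\<close>


section \<open>A map with locally nilpotent transpose is nilpotent\<close>

lemma transpose_map_funpow: "(transpose_map f ^^ i) \<phi> = \<phi> \<circ> (f ^^ i)"
  by (induction i arbitrary: \<phi>) (simp_all add: transpose_map_def fun_eq_iff funpow_swap1)

lemma linear_funpow:
  assumes "vector_space s" "Vector_Spaces.linear s s f"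
  shows "Vector_Spaces.linear s s (f ^^ n)"
proof (induction n)
  case 0
  from vector_space.linear_id[OF assms(1)] show ?case by (simp add: id_def)
next
  case (Suc n)
  show ?case using Vector_Spaces.linear_compose[OF Suc assms(2)] by (simp add: o_def)
qed

lemma funpow_zero_mono:
  assumes "vector_space s" "Vector_Spaces.linear s s f" "\<forall>x. (f ^^ N) x = 0" "N \<le> i"
  shows "(f ^^ i) x = 0"
proof -
  from assms(4) obtain k where "i = k + N" by (metis add.commute le_Suc_ex)
  then have "(f ^^ i) x = (f ^^ k) 0" using assms(3) by (simp add: funpow_add)
  also have "\<dots> = 0"
    using linear_funpow[OF assms(1,2), of k] module_hom.zero
    by (auto simp: Vector_Spaces.linear_def)
  finally show ?thesis .
qed

text \<open>A relation between such vectors would put the vector of least index into the next, smaller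
  subspace, which contains all the others.\<close>

lemma independent_descending_chain:
  assumes "vector_space s" and sub: "\<And>n. module.subspace s (F n)"
    and desc: "\<And>m n. m \<le> n \<Longrightarrow> F n \<subseteq> F m"
    and x: "\<And>n. x n \<in> F n - F (Suc n)"
  shows "\<not> module.dependent s (range x)"
proof -
  interpret vector_space s by fact
  have fin: "independent (x ` {n..<n + m})" for n m
  proof (induction m arbitrary: n)
    case 0
    then show ?case by (simp add: independent_empty)
  next
    case (Suc m)
    have "{n..<n + Suc m} = insert n {Suc n..<Suc n + m}" by auto
    moreover
    have "span (x ` {Suc n..<Suc n + m}) \<subseteq> F (Suc n)"
      using x desc by (intro span_minimal sub) fastforce
    then have "x n \<notin> span (x ` {Suc n..<Suc n + m})" using x[of n] by blast
    ultimately show ?case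
      using Suc.IH[of "Suc n"] independent_insertI by (metis image_insert)

  qed
  have "independent (\<Union>m. x ` {0..<m})"
  proof (rule independent_Union_directed)
    fix c d assume "c \<in> range (\<lambda>m. x ` {0..<m})" "d \<in> range (\<lambda>m. x ` {0..<m})"
    then obtain m m' where "c = x ` {0..<m}" "d = x ` {0..<m'}" by auto
    then show "c \<subseteq> d \<or> d \<subseteq> c" by (cases "m \<le> m'") (auto intro!: image_mono)
  qed (use fin[of 0] in auto)
  moreover have "(\<Union>m. x ` {0..<m}) = range x"
    by (auto intro!: image_eqI[OF refl] exI[of _ "Suc _"])
  ultimately show ?thesis by simp
qed

text \<open>
  If the images of the powers of \<open>f\<close> never become stationary, vectors \<open>f\<^sup>n(z\<^sub>n)\<close> outside the
  next image are linearly independent, and one linear form takes the value \<open>1\<close> at all of them; no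
  power of the transpose kills it. If they become stationary at a nonzero subspace, a
  form that does not vanish on this subspace is not killed either.
\<close>

lemma nilpotent_if_transpose_locally_nilpotent:
  assumes vs: "vector_space s" and lin: "Vector_Spaces.linear s s f"
    and nil: "locally_nilpotent_on (dual_space s) (transpose_map f)"
  obtains N where "\<forall>x. (f ^^ N) x = 0"
proof -
  interpret vector_space s by fact
  interpret vector_space_pair s "(*)"
    by (simp add: vector_space_pair_def vs vector_space_over_itself.vector_space_axioms)
  have kills: "\<exists>m. \<forall>x. \<phi> ((f ^^ m) x) = 0" if "Vector_Spaces.linear s (*) \<phi>" for \<phi>
  proof -
    from that nil obtain m where "(transpose_map f ^^ m) \<phi> = 0"
      by (auto simp: locally_nilpotent_on_def dual_space_def)
    then show ?thesis by (auto simp: transpose_map_funpow fun_eq_iff)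
  qed
  have desc: "range (f ^^ n) \<subseteq> range (f ^^ m)" if "m \<le> n" for m n
  proof -
    from that obtain k where "n = m + k" by (metis le_Suc_ex)
    then show ?thesis by (auto simp: funpow_add)
  qed
  show thesis
  proof (cases "\<exists>n. range (f ^^ n) \<subseteq> range (f ^^ Suc n)")
    case True
    then obtain n where n: "range (f ^^ n) \<subseteq> range (f ^^ Suc n)" by blast
    have stable: "range (f ^^ n) \<subseteq> range (f ^^ (n + k))" for k
    proof (induction k)
      case (Suc k)
      have "z \<in> range (f ^^ (n + Suc k))" if z: "z \<in> range (f ^^ n)" for z
      proof -
        from z n obtain t where "z = f ((f ^^ n) t)" by auto
        moreover from Suc obtain t' where "(f ^^ n) t = (f ^^ (n + k)) t'" by blast
        ultimately have "z = (f ^^ (n + Suc k)) t'" by simp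
        then show ?thesis by blast
      qed
      then show ?case by blast
    qed simp
    have "(f ^^ n) x = 0" for x
    proof (rule ccontr)
      assume "(f ^^ n) x \<noteq> 0"
      then have "independent {(f ^^ n) x}" by (simp add: dependent_single)
      then obtain \<phi> where \<phi>: "Vector_Spaces.linear s (*) \<phi>" "\<phi> ((f ^^ n) x) = 1"
        using linear_independent_extend[of "{(f ^^ n) x}" "\<lambda>_. 1"] by auto
      from kills[OF \<phi>(1)] obtain m where m: "\<And>x. \<phi> ((f ^^ m) x) = 0" by blast
      from stable[of m] obtain t where "(f ^^ n) x = (f ^^ (n + m)) t" by blast
      also have "\<dots> = (f ^^ m) ((f ^^ n) t)" by (simp add: funpow_add add.commute[of n])
      finally show False using m \<phi>(2) by simp
    qed
    then show thesis using that by blast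
  next
    case False
    then have "\<forall>n. \<exists>z. (f ^^ n) z \<notin> range (f ^^ Suc n)" by blast
    then obtain z where z: "\<And>n. (f ^^ n) (z n) \<notin> range (f ^^ Suc n)" by metis
    have "independent (range (\<lambda>n. (f ^^ n) (z n)))"
    proof (rule independent_descending_chain[OF vs, where F = "\<lambda>n. range (f ^^ n)"])
      show "subspace (range (f ^^ n))" for n
        using linear_funpow[OF vs lin, of n] subspace_UNIV
        by (auto simp: Vector_Spaces.linear_def intro: module_hom.subspace_image)
    qed (use desc z in auto)
    then obtain \<phi> where \<phi>: "Vector_Spaces.linear s (*) \<phi>" "\<And>n. \<phi> ((f ^^ n) (z n)) = 1"
      using linear_independent_extend[of "range (\<lambda>n. (f ^^ n) (z n))" "\<lambda>_. 1"] by auto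
    from kills[OF \<phi>(1)] obtain m where "\<And>x. \<phi> ((f ^^ m) x) = 0" by blast
    with \<phi>(2)[of m] show thesis by simp
  qed
qed

section \<open>Linear forms on free vector spaces\<close>

lemma sum_fun_apply: "(\<Sum>i\<in>I. t i) x = (\<Sum>i\<in>I. t i x)"
  by (induction I rule: infinite_finite_induct) auto

text \<open>The linear form with prescribed values on the basis. Expressing the pairing, the characters and
  their tensor products as such forms turns every \<^const>\<open>lin_ext\<close> of the coproduct into a
  composition of value functions.\<close>

definition form_ext :: "('a \<Rightarrow> 'k) \<Rightarrow> ('a \<Rightarrow>\<^sub>0 'k) \<Rightarrow> 'k::field" where
  "form_ext \<phi> p = (\<Sum>a\<in>Poly_Mapping.keys p. Poly_Mapping.lookup p a * \<phi> a)"

lemma form_ext_superset: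
  assumes "finite A" "Poly_Mapping.keys p \<subseteq> A"
  shows "form_ext \<phi> p = (\<Sum>a\<in>A. Poly_Mapping.lookup p a * \<phi> a)"
  unfolding form_ext_def using assms by (intro sum.mono_neutral_left) (auto simp: in_keys_iff)

lemma form_ext_cong:
  "(\<And>a. a \<in> Poly_Mapping.keys p \<Longrightarrow> \<phi> a = \<psi> a) \<Longrightarrow> form_ext \<phi> p = form_ext \<psi> p"
  unfolding form_ext_def by (intro sum.cong) auto

lemma form_ext_zero [simp]: "form_ext \<phi> 0 = 0"
  by (simp add: form_ext_def)

lemma form_ext_single [simp]: "form_ext \<phi> (Poly_Mapping.single a c) = c * \<phi> a"
  by (subst form_ext_superset[of "{a}"]) auto

lemma form_ext_add [simp]: "form_ext \<phi> (p + q) = form_ext \<phi> p + form_ext \<phi> q"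
proof -
  have "Poly_Mapping.keys (p + q) \<subseteq> Poly_Mapping.keys p \<union> Poly_Mapping.keys q" by (rule keys_add)
  then show ?thesis
    by (simp add: form_ext_superset[of "Poly_Mapping.keys p \<union> Poly_Mapping.keys q"] lookup_add
        algebra_simps sum.distrib)
qed

lemma form_ext_scale [simp]: "form_ext \<phi> (scale_pm c p) = c * form_ext \<phi> p"
  by (subst form_ext_superset[OF _ keys_scale_pm])
    (simp_all add: form_ext_def sum_distrib_left mult.assoc)

lemma form_ext_sum: "form_ext \<phi> (\<Sum>i\<in>I. p i) = (\<Sum>i\<in>I. form_ext \<phi> (p i))"
  by (induction I rule: infinite_finite_induct) auto

lemma form_ext_lin_ext: "form_ext \<phi> (lin_ext \<psi> p) = form_ext (\<lambda>a. form_ext \<phi> (\<psi> a)) p"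
  by (simp add: lin_ext_def form_ext_sum form_ext_def[of "\<lambda>a. form_ext \<phi> (\<psi> a)"])

lemma form_ext_mult_left: "form_ext (\<lambda>a. c * \<phi> a) p = c * form_ext \<phi> p"
  unfolding form_ext_def sum_distrib_left by (intro sum.cong) (auto simp: mult_ac)

lemma form_ext_mult_right: "form_ext (\<lambda>a. \<phi> a * c) p = form_ext \<phi> p * c"
  unfolding form_ext_def sum_distrib_right by (intro sum.cong) (auto simp: mult_ac)

lemma form_ext_fun_zero: "form_ext (\<lambda>a. 0) p = 0"
  by (simp add: form_ext_def)

lemma form_ext_fun_sum: "form_ext (\<lambda>a. \<Sum>i\<in>I. \<phi> i a) p = (\<Sum>i\<in>I. form_ext (\<phi> i) p)"
  unfolding form_ext_def sum_distrib_left by (rule sum.swap)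

lemma form_ext_fun_add: "form_ext (\<lambda>a. \<phi> a + \<psi> a) p = form_ext \<phi> p + form_ext \<psi> p"
  by (simp add: form_ext_def algebra_simps sum.distrib)

lemma scale_pm_zero: "scale_pm c 0 = 0"
  by (rule poly_mapping_eqI) simp

lemma lin_ext_fun_zero: "lin_ext (\<lambda>a. 0) p = 0"
  by (simp add: lin_ext_def scale_pm_zero)

lemma tensor_pm_zero_left: "tensor_pm 0 q = 0"
  by (simp add: tensor_pm_def lin_ext_def)

lemma form_ext_tensor:
  "form_ext \<phi> (tensor_pm p q) = form_ext (\<lambda>a. form_ext (\<lambda>b. \<phi> (a, b)) q) p"
  by (simp add: tensor_pm_def form_ext_lin_ext)

lemma sum_single_keys:
  "p = (\<Sum>a\<in>Poly_Mapping.keys p. Poly_Mapping.single a (Poly_Mapping.lookup p a))"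
proof (rule poly_mapping_eqI)
  fix x
  have "(\<Sum>a\<in>Poly_Mapping.keys p. Poly_Mapping.lookup p a when a = x) = Poly_Mapping.lookup p x"
    by (simp add: when_def in_keys_iff)
  then show "Poly_Mapping.lookup p x = Poly_Mapping.lookup
      (\<Sum>a\<in>Poly_Mapping.keys p. Poly_Mapping.single a (Poly_Mapping.lookup p a)) x"
    by (simp add: lookup_sum lookup_single)
qed

lemma form_ext_times:
  assumes "\<And>a b. \<phi> (a + b) = \<phi> a * \<phi> b"
  shows "form_ext \<phi> (p * q) = form_ext \<phi> p * form_ext \<phi> q"
proof -
  have "form_ext \<phi> (p * q) =
      form_ext \<phi> ((\<Sum>a\<in>Poly_Mapping.keys p. Poly_Mapping.single a (Poly_Mapping.lookup p a)) *
        (\<Sum>b\<in>Poly_Mapping.keys q. Poly_Mapping.single b (Poly_Mapping.lookup q b)))"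
    by (simp only: sum_single_keys[symmetric])
  also have "\<dots> = form_ext \<phi> p * form_ext \<phi> q"
    unfolding sum_product form_ext_sum mult_single form_ext_single assms
    by (simp add: form_ext_def sum_product mult_ac)
  finally show ?thesis .
qed

lemma form_ext_prod_mset:
  assumes "\<And>a b. \<phi> (a + b) = \<phi> a * \<phi> b" "\<phi> 0 = 1"
  shows "form_ext \<phi> (\<Prod>w\<in>#M. p w) = (\<Prod>w\<in>#M. form_ext \<phi> (p w))"
proof (induction M)
  case empty
  show ?case using assms(2) by (simp flip: single_one)
qed (simp add: form_ext_times assms)


section \<open>Shuffles of words and of infinite sums of words\<close>

lemma shuffle_words_Nil_right [simp]: "shuffle_words a [] = {#a#}"
  by (cases a) auto

lemma length_set_shuffle_words:
  "w \<in># shuffle_words a b \<Longrightarrow> length w = length a + length b \<and> set w = set a \<union> set b"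
  by (induction a b arbitrary: w rule: shuffle_words.induct) fastforce+

lemma finite_unshuffles: "finite {(a, b). w \<in># shuffle_words a b}"
proof -
  let ?L = "{a. set a \<subseteq> set w \<and> length a \<le> length w}"
  have "{(a, b). w \<in># shuffle_words a b} \<subseteq> ?L \<times> ?L"
    using length_set_shuffle_words by fastforce
  moreover have "finite ?L" by (rule finite_lists_length_le) simp
  ultimately show ?thesis by (meson finite_SigmaI finite_subset)
qed

text \<open>Sums over words range over supports that change with the summands. The lemmas with \<open>superset\<close> in
  their names replace them by sums over one finite set, so that they can be added and interchanged.\<close>

lemma shuffle_superset:
  assumes "finite P" and "\<And>a b. w \<in># shuffle_words a b \<Longrightarrow> u a \<noteq> 0 \<Longrightarrow> v b \<noteq> 0 \<Longrightarrow> (a, b) \<in> P"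
  shows "shuffle u v w =
    (\<Sum>(a, b)\<in>P. of_nat (count (shuffle_words a b) w) * (u a * v b))"
proof -
  have "shuffle u v w = (\<Sum>(a, b) | w \<in># shuffle_words a b \<and> u a \<noteq> 0 \<and> v b \<noteq> 0.
      of_nat (count (shuffle_words a b) w) * (u a * v b))"
    unfolding shuffle_def using finite_unshuffles by (intro sum.mono_neutral_right) auto
  also have "\<dots> = (\<Sum>(a, b)\<in>P. of_nat (count (shuffle_words a b) w) * (u a * v b))"
    using assms by (intro sum.mono_neutral_left) (auto intro: count_inI)
  finally show ?thesis .
qed

lemma shuffle_neq_0D:
  assumes "shuffle u v w \<noteq> 0"
  obtains a b where "w \<in># shuffle_words a b" "u a \<noteq> 0" "v b \<noteq> 0"
proof -
  from assms obtain ab where "ab \<in> {(a, b). w \<in># shuffle_words a b}"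
    "(case ab of (a, b) \<Rightarrow> of_nat (count (shuffle_words a b) w) * (u a * v b)) \<noteq> 0"
    unfolding shuffle_def using sum.not_neutral_contains_not_neutral by blast
  then show thesis using that by auto
qed

lemma shuffle_empty_word [simp]: "shuffle u empty_word = u"
proof
  fix w
  have "shuffle u empty_word w =
      (\<Sum>(a, b)\<in>{(w, [])}. of_nat (count (shuffle_words a b) w) * (u a * empty_word b))"
    by (rule shuffle_superset) (auto simp: empty_word_def split: if_splits)
  then show "shuffle u empty_word w = u w" by (simp add: empty_word_def)
qed

text \<open>A coefficient at \<open>w\<close> only involves words of length at most \<open>\<bar>w\<bar>\<close>; so an infinite sum on the left may
  be replaced by a finite one that has the same short words.\<close>

lemma shuffle_sum_left:
  assumes "finite A" "\<And>a. length a \<le> length w \<Longrightarrow> u a = (\<Sum>i\<in>A. c i * t i a)"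
  shows "shuffle u v w = (\<Sum>i\<in>A. c i * shuffle (t i) v w)"
proof -
  have "shuffle u v w = (\<Sum>(a, b) | w \<in># shuffle_words a b.
      \<Sum>i\<in>A. c i * (of_nat (count (shuffle_words a b) w) * (t i a * v b)))"
    unfolding shuffle_def
  proof (intro sum.cong refl, clarify)
    fix a b assume "w \<in># shuffle_words a b"
    then have "u a = (\<Sum>i\<in>A. c i * t i a)"
      using length_set_shuffle_words by (intro assms) fastforce
    then show "of_nat (count (shuffle_words a b) w) * (u a * v b) =
        (\<Sum>i\<in>A. c i * (of_nat (count (shuffle_words a b) w) * (t i a * v b)))"
      by (simp add: sum_distrib_left sum_distrib_right mult_ac)
  qed
  also have "\<dots> = (\<Sum>i\<in>A. \<Sum>(a, b) | w \<in># shuffle_words a b.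
      c i * (of_nat (count (shuffle_words a b) w) * (t i a * v b)))"
    by (simp add: case_prod_unfold sum.swap[of _ A])
  also have "\<dots> = (\<Sum>i\<in>A. c i * shuffle (t i) v w)"
    by (simp add: shuffle_def sum_distrib_left case_prod_unfold)
  finally show ?thesis .
qed

lemma completed_finite_le:
  assumes "u \<in> completed_tensor_alg B"
  shows "finite {w. length w \<le> n \<and> u w \<noteq> 0}"
proof -
  have "{w. length w \<le> n \<and> u w \<noteq> 0} = (\<Union>m\<le>n. {w. length w = m \<and> u w \<noteq> 0})" by auto
  then show ?thesis using assms by (simp add: completed_tensor_alg_def)
qed

lemma completedI:
  assumes "\<And>w. u w \<noteq> 0 \<Longrightarrow> w \<in> lists B"
    and "\<And>n. finite (A n)" "\<And>w. u w \<noteq> 0 \<Longrightarrow> w \<in> A (length w)"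
  shows "u \<in> completed_tensor_alg B"
  unfolding completed_tensor_alg_def
proof (intro CollectI conjI allI)
  fix n
  have "{w. length w = n \<and> u w \<noteq> 0} \<subseteq> A n" using assms(3) by auto
  then show "finite {w. length w = n \<and> u w \<noteq> 0}" using assms(2) finite_subset by blast
qed (use assms(1) in auto)

lemma completedD: "u \<in> completed_tensor_alg B \<Longrightarrow> u w \<noteq> 0 \<Longrightarrow> w \<in> lists B"
  by (auto simp: completed_tensor_alg_def)

lemma completed_empty_word [simp]: "empty_word \<in> completed_tensor_alg B"
  by (rule completedI[where A = "\<lambda>_. {[]}"]) (auto simp: empty_word_def split: if_splits)

lemma completed_zero [simp]: "0 \<in> completed_tensor_alg B"
  by (simp add: completed_tensor_alg_def)

lemma completed_add:
  assumes "u \<in> completed_tensor_alg B" "v \<in> completed_tensor_alg B"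
  shows "u + v \<in> completed_tensor_alg B"
proof (rule completedI)
  let ?A = "\<lambda>n. {w. length w \<le> n \<and> u w \<noteq> 0} \<union> {w. length w \<le> n \<and> v w \<noteq> 0}"
  show "finite (?A n)" for n using assms by (simp add: completed_finite_le)
  fix w assume "(u + v) w \<noteq> 0"
  then have "u w \<noteq> 0 \<or> v w \<noteq> 0" by auto
  then show "w \<in> lists B" "w \<in> ?A (length w)" using assms completedD by auto
qed

lemma completed_scale:
  assumes "u \<in> completed_tensor_alg B"
  shows "fun_scale c u \<in> completed_tensor_alg B"
proof (rule completedI)
  show "finite {w. length w \<le> n \<and> u w \<noteq> 0}" for n using assms by (rule completed_finite_le)
qed (use assms completedD in \<open>auto simp: fun_scale_def\<close>)

lemma completed_sum:
  "(\<And>i. i \<in> I \<Longrightarrow> u i \<in> completed_tensor_alg B) \<Longrightarrow> (\<Sum>i\<in>I. u i) \<in> completed_tensor_alg B"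
  by (induction I rule: infinite_finite_induct) (auto simp: completed_add)

lemma completed_shuffle:
  assumes "u \<in> completed_tensor_alg B" "v \<in> completed_tensor_alg B"
  shows "shuffle u v \<in> completed_tensor_alg B"
proof (rule completedI)
  let ?A = "\<lambda>n. \<Union>a\<in>{a. length a \<le> n \<and> u a \<noteq> 0}. \<Union>b\<in>{b. length b \<le> n \<and> v b \<noteq> 0}.
      set_mset (shuffle_words a b)"
  show "finite (?A n)" for n
    using assms by (intro finite_UN_I completed_finite_le) auto
  fix w assume "shuffle u v w \<noteq> 0"
  then obtain a b where ab: "w \<in># shuffle_words a b" "u a \<noteq> 0" "v b \<noteq> 0"
    by (rule shuffle_neq_0D)
  note w = length_set_shuffle_words[OF ab(1)]
  have "a \<in> lists B" "b \<in> lists B" using ab assms completedD by blast+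
  then show "w \<in> lists B" using w by (auto simp: in_lists_conv_set)
  have "a \<in> {a. length a \<le> length w \<and> u a \<noteq> 0}" "b \<in> {b. length b \<le> length w \<and> v b \<noteq> 0}"
    using ab w by auto
  then show "w \<in> ?A (length w)" using ab(1) by blast
qed

lemma completed_shuffle_power:
  "v \<in> completed_tensor_alg B \<Longrightarrow> shuffle_power v i \<in> completed_tensor_alg B"
  unfolding shuffle_power_def by (induction i) (auto intro: completed_shuffle)

lemma completed_letter_conc:
  assumes "vector_space s" "u \<in> completed_tensor_alg B"
  shows "letter_conc s B x u \<in> completed_tensor_alg B"
proof -
  interpret vector_space s by fact
  show ?thesis
  proof (rule completedI)
    let ?A = "\<lambda>n. (\<lambda>(b, w). b # w) ` ({b. representation B x b \<noteq> 0} \<times> {w. length w \<le> n \<and> u w \<noteq> 0})"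
    show "finite (?A n)" for n
      using assms by (intro finite_imageI finite_SigmaI finite_representation completed_finite_le)
    fix w assume "letter_conc s B x u w \<noteq> 0"
    then obtain b w' where w: "w = b # w'" "representation B x b \<noteq> 0" "u w' \<noteq> 0"
      by (auto simp: letter_conc_def split: list.splits)
    then show "w \<in> ?A (length w)" by auto
    show "w \<in> lists B" using w representation_ne_zero completedD[OF assms(2)] by auto
  qed
qed

lemma letter_conc_Nil [simp]: "letter_conc s B x u [] = 0"
  and letter_conc_Cons [simp]: "letter_conc s B x u (b # w) = module.representation s B x b * u w"
  by (simp_all add: letter_conc_def)

lemma letter_conc_0:
  assumes "vector_space s"
  shows "letter_conc s B 0 u = 0"
proof -
  interpret vector_space s by fact
  show ?thesis by (auto simp: letter_conc_def representation_zero split: list.split)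
qed

section \<open>The pairing and the duality between shuffles and unshuffles\<close>

fun word_pairing :: "'v list \<Rightarrow> ('v \<Rightarrow> 'k) list \<Rightarrow> 'k::field" where
  "word_pairing [] [] = 1"
| "word_pairing (x # xs) (y # ys) = y x * word_pairing xs ys"
| "word_pairing _ _ = 0"

lemma word_pairing_eq:
  "word_pairing x y = (if length x = length y then \<Prod>i<length y. (y ! i) (x ! i) else 0)"
  by (induction x y rule: word_pairing.induct) (auto simp: prod.lessThan_Suc_shift simp del: prod.lessThan_Suc)

definition pairing_word :: "('v list \<Rightarrow> 'k::field) \<Rightarrow> ('v \<Rightarrow> 'k) list \<Rightarrow> 'k" where
  "pairing_word t y = (\<Sum>x | length x = length y \<and> t x \<noteq> 0. t x * word_pairing x y)"

lemma pairing_eq_form_ext: "pairing t = form_ext (pairing_word t)"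
  unfolding pairing_def form_ext_def pairing_word_def
  by (intro ext sum.cong refl arg_cong2[where f = "(*)"]) (auto simp: word_pairing_eq)

lemma pairing_word_superset:
  assumes "finite A" "\<And>x. length x = length y \<Longrightarrow> t x \<noteq> 0 \<Longrightarrow> x \<in> A"
  shows "pairing_word t y = (\<Sum>x\<in>A. t x * word_pairing x y)"
  unfolding pairing_word_def using assms
  by (intro sum.mono_neutral_left) (auto simp: word_pairing_eq split: if_splits)

lemma pairing_word_cong:
  "(\<And>x. length x = length y \<Longrightarrow> t x = t' x) \<Longrightarrow> pairing_word t y = pairing_word t' y"
  unfolding pairing_word_def by (intro sum.cong) auto

lemma pairing_word_single: "pairing_word (\<lambda>x. if x = w then 1 else 0) y = word_pairing w y"
  by (subst pairing_word_superset[of "{w}"]) (auto split: if_splits)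

lemma pairing_word_sum:
  assumes "finite I" "\<And>i. i \<in> I \<Longrightarrow> t i \<in> completed_tensor_alg B"
  shows "pairing_word (\<Sum>i\<in>I. fun_scale (c i) (t i)) y = (\<Sum>i\<in>I. c i * pairing_word (t i) y)"
proof -
  define A where "A = (\<Union>i\<in>I. {x. length x \<le> length y \<and> t i x \<noteq> 0})"
  have A: "finite A" unfolding A_def using assms completed_finite_le by blast
  have app: "(\<Sum>i\<in>I. fun_scale (c i) (t i)) x = (\<Sum>i\<in>I. c i * t i x)" for x
    by (simp add: sum_fun_apply fun_scale_def)
  have "pairing_word (\<Sum>i\<in>I. fun_scale (c i) (t i)) y =
      (\<Sum>x\<in>A. (\<Sum>i\<in>I. c i * t i x) * word_pairing x y)"
  proof (subst pairing_word_superset[OF A])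
    fix x assume "length x = length y" "(\<Sum>i\<in>I. fun_scale (c i) (t i)) x \<noteq> 0"
    then obtain i where "i \<in> I" "c i * t i x \<noteq> 0"
      unfolding app using sum.not_neutral_contains_not_neutral by blast
    then show "x \<in> A" using \<open>length x = length y\<close> by (auto simp: A_def)
  qed (simp add: app)
  also have "\<dots> = (\<Sum>i\<in>I. c i * (\<Sum>x\<in>A. t i x * word_pairing x y))"
    by (simp add: sum_distrib_left sum_distrib_right sum.swap[of _ A] mult_ac)
  also have "\<dots> = (\<Sum>i\<in>I. c i * pairing_word (t i) y)"
    by (intro sum.cong refl arg_cong2[where f = "(*)"] pairing_word_superset[symmetric] A)
      (auto simp: A_def)
  finally show ?thesis .
qed

lemma sum_count_superset:
  assumes "finite A" "set_mset M \<subseteq> A"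
  shows "(\<Sum>w\<in>A. of_nat (count M w) * h w) = (\<Sum>w\<in>#M. h w :: 'k::comm_semiring_1)"
  using assms(2)
proof (induction M)
  case (add w M)
  have "(\<Sum>x\<in>A. of_nat (count (add_mset w M) x) * h x) =
      (\<Sum>x\<in>A. (if w = x then h x else 0) + of_nat (count M x) * h x)"
    by (intro sum.cong) (auto simp: algebra_simps)
  then show ?case using add assms(1) by (simp add: sum.distrib)
qed simp

text \<open>Removing the first letter \<open>z\<close> of \<open>y\<close>: on the left it is paired with the first letter of a shuffle, which
  is the first letter of \<open>a\<close> or of \<open>b\<close>; on the right it goes to the first or to the second factor of
  the coproduct. So both sides satisfy the same recursion.\<close>

lemma word_pairing_shuffle:
  fixes y :: "('v \<Rightarrow> 'k::field) list"
  shows "(\<Sum>w\<in>#shuffle_words a b. word_pairing w y) =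
     form_ext (\<lambda>(p, q). word_pairing a p * word_pairing b q) (unshuffle y)"
proof (induction y arbitrary: a b)
  case Nil
  show ?case by (cases a; cases b) (auto simp: image_mset.compositionality o_def)
next
  case (Cons z y)
  have step: "form_ext (\<lambda>(p, q). word_pairing a p * word_pairing b q) (unshuffle (z # y)) =
      form_ext (\<lambda>(p, q). word_pairing a (z # p) * word_pairing b q) (unshuffle y) +
      form_ext (\<lambda>(p, q). word_pairing a p * word_pairing b (z # q)) (unshuffle y)" for a b
    by (simp add: form_ext_lin_ext case_prod_unfold flip: form_ext_fun_add)
  have left: "form_ext (\<lambda>(p, q). word_pairing (x # a) (z # p) * word_pairing b q) (unshuffle y) =
      z x * (\<Sum>w\<in>#shuffle_words a b. word_pairing w y)" for x a b
    by (simp add: Cons.IH case_prod_unfold mult.assoc flip: form_ext_mult_left)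
  have right: "form_ext (\<lambda>(p, q). word_pairing a p * word_pairing (x # b) (z # q)) (unshuffle y) =
      z x * (\<Sum>w\<in>#shuffle_words a b. word_pairing w y)" for x a b
    by (simp add: Cons.IH case_prod_unfold mult_ac flip: form_ext_mult_left)
  have zero: "form_ext (\<lambda>(p, q). 0) q = 0" for q :: "_ \<Rightarrow>\<^sub>0 'k"
    by (simp add: case_prod_unfold form_ext_fun_zero)
  show ?case
    unfolding step
    by (cases a; cases b)
      (simp_all add: left right zero image_mset.compositionality o_def sum_mset_distrib_left
        del: word_pairing.simps(2), simp_all add: case_prod_unfold form_ext_def sum_mset_distrib_left)
qed

lemma pairing_word_shuffle:
  assumes "u \<in> completed_tensor_alg B" "v \<in> completed_tensor_alg B"
  shows "pairing_word (shuffle u v) y =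
    form_ext (\<lambda>(p, q). pairing_word u p * pairing_word v q) (unshuffle y)"
proof -
  define U where "U = {a. length a \<le> length y \<and> u a \<noteq> 0}"
  define V where "V = {b. length b \<le> length y \<and> v b \<noteq> 0}"
  have fin: "finite U" "finite V" unfolding U_def V_def using assms completed_finite_le by blast+
  define A where "A = (\<Union>(a, b)\<in>U \<times> V. set_mset (shuffle_words a b))"
  have A: "finite A" using fin by (auto simp: A_def)
  have UV: "(a, b) \<in> U \<times> V"
    if "w \<in># shuffle_words a b" "u a \<noteq> 0" "v b \<noteq> 0" "length w = length y" for a b w
    using length_set_shuffle_words[OF that(1)] that by (auto simp: U_def V_def)
  have "pairing_word (shuffle u v) y = (\<Sum>w | w \<in> A \<and> length w = length y. shuffle u v w * word_pairing w y)"
  proof (rule pairing_word_superset)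
    show "finite {w. w \<in> A \<and> length w = length y}" by (rule finite_subset[OF _ A]) auto
  qed (auto elim!: shuffle_neq_0D dest: UV simp: A_def)
  also have "\<dots> = (\<Sum>w | w \<in> A \<and> length w = length y. \<Sum>ab\<in>U \<times> V. u (fst ab) * v (snd ab) *
      (of_nat (count (shuffle_words (fst ab) (snd ab)) w) * word_pairing w y))"
  proof (intro sum.cong refl)
    fix w assume "w \<in> {w. w \<in> A \<and> length w = length y}"
    then have "shuffle u v w =
        (\<Sum>(a, b)\<in>U \<times> V. of_nat (count (shuffle_words a b) w) * (u a * v b))"
      using fin UV by (intro shuffle_superset) auto
    then show "shuffle u v w * word_pairing w y = (\<Sum>ab\<in>U \<times> V. u (fst ab) * v (snd ab) *
      (of_nat (count (shuffle_words (fst ab) (snd ab)) w) * word_pairing w y))"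
      by (simp add: sum_distrib_left case_prod_unfold mult_ac)
  qed
  also have "\<dots> = (\<Sum>w\<in>A. \<Sum>ab\<in>U \<times> V. u (fst ab) * v (snd ab) *
      (of_nat (count (shuffle_words (fst ab) (snd ab)) w) * word_pairing w y))"
    using A by (intro sum.mono_neutral_left) (auto simp: word_pairing_eq)
  also have "\<dots> = (\<Sum>ab\<in>U \<times> V. u (fst ab) * v (snd ab) *
      (\<Sum>w\<in>A. of_nat (count (shuffle_words (fst ab) (snd ab)) w) * word_pairing w y))"
    by (subst sum.swap) (simp add: sum_distrib_left)
  also have "\<dots> = (\<Sum>ab\<in>U \<times> V. u (fst ab) * v (snd ab) *
      form_ext (\<lambda>(p, q). word_pairing (fst ab) p * word_pairing (snd ab) q) (unshuffle y))"
  proof (intro sum.cong refl arg_cong2[where f = "(*)"])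
    fix ab assume "ab \<in> U \<times> V"
    then have "set_mset (shuffle_words (fst ab) (snd ab)) \<subseteq> A" by (auto simp: A_def)
    then have "(\<Sum>w\<in>A. of_nat (count (shuffle_words (fst ab) (snd ab)) w) * word_pairing w y) =
        (\<Sum>w\<in>#shuffle_words (fst ab) (snd ab). word_pairing w y)"
      using A by (intro sum_count_superset)
    then show "(\<Sum>w\<in>A. of_nat (count (shuffle_words (fst ab) (snd ab)) w) * word_pairing w y) =
        form_ext (\<lambda>(p, q). word_pairing (fst ab) p * word_pairing (snd ab) q) (unshuffle y)"
      by (simp only: word_pairing_shuffle)
  qed
  also have "\<dots> = form_ext (\<lambda>(p, q). \<Sum>ab\<in>U \<times> V. u (fst ab) * v (snd ab) *
      (word_pairing (fst ab) p * word_pairing (snd ab) q)) (unshuffle y)"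
    by (simp add: case_prod_unfold form_ext_fun_sum form_ext_mult_left)
  also have "\<dots> = form_ext (\<lambda>(p, q). pairing_word u p * pairing_word v q) (unshuffle y)"
  proof (intro form_ext_cong, clarify)
    fix p q :: "('a \<Rightarrow> 'b) list"
    assume "(p, q) \<in> Poly_Mapping.keys (unshuffle y :: _ \<Rightarrow>\<^sub>0 'b)"
    from keys_unshuffle[OF this] have len: "length p \<le> length y" "length q \<le> length y" by auto
    have "pairing_word u p = (\<Sum>a\<in>U. u a * word_pairing a p)"
      using fin len by (intro pairing_word_superset) (auto simp: U_def)
    moreover have "pairing_word v q = (\<Sum>b\<in>V. v b * word_pairing b q)"
      using fin len by (intro pairing_word_superset) (auto simp: V_def)
    ultimately show "(\<Sum>ab\<in>U \<times> V. u (fst ab) * v (snd ab) *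
        (word_pairing (fst ab) p * word_pairing (snd ab) q)) = pairing_word u p * pairing_word v q"
      by (simp add: sum_product sum.cartesian_product case_prod_unfold mult_ac)
  qed
  finally show ?thesis .
qed

text \<open>Splitting off the first tensor factor of the iterated coproduct leaves the same expression with
  \<open>v\<close> in place of \<open>u\<close>, that is, with the next shuffle power of \<open>v\<close> in the second factor. The
  induction therefore needs \<open>u\<close> to be arbitrary.\<close>

lemma pairing_word_iter_unshuffle:
  assumes "u \<in> completed_tensor_alg B" "v \<in> completed_tensor_alg B"
  shows "form_ext (\<lambda>ws. pairing_word u (hd ws) * (\<Prod>w\<leftarrow>tl ws. pairing_word v w)) (iter_unshuffle i y) =
    pairing_word (shuffle u (shuffle_power v i)) y"
  using assms(1)
proof (induction i arbitrary: u y)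
  case 0
  then show ?case by (simp add: shuffle_power_def)
next
  case (Suc i)
  have "form_ext (\<lambda>ws. pairing_word u (hd ws) * (\<Prod>w\<leftarrow>tl ws. pairing_word v w)) (iter_unshuffle (Suc i) y) =
      form_ext (\<lambda>(p, q). pairing_word u p *
        form_ext (\<lambda>us. \<Prod>w\<leftarrow>us. pairing_word v w) (iter_unshuffle i q)) (unshuffle y)"
    by (simp add: form_ext_lin_ext case_prod_unfold form_ext_mult_left)
  also have "\<dots> = form_ext (\<lambda>(p, q). pairing_word u p *
        form_ext (\<lambda>us. pairing_word v (hd us) * (\<Prod>w\<leftarrow>tl us. pairing_word v w)) (iter_unshuffle i q)) (unshuffle y)"
  proof -
    have "form_ext (\<lambda>us. \<Prod>w\<leftarrow>us. pairing_word v w) (iter_unshuffle i q) =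
        form_ext (\<lambda>us. pairing_word v (hd us) * (\<Prod>w\<leftarrow>tl us. pairing_word v w)) (iter_unshuffle i q)" for q
    proof (rule form_ext_cong)
      fix us :: "('a \<Rightarrow> 'b) list list"
      assume "us \<in> Poly_Mapping.keys (iter_unshuffle i q :: _ \<Rightarrow>\<^sub>0 'b)"
      from keys_iter_unshuffle[OF this] have "us \<noteq> []" by auto
      then show "(\<Prod>w\<leftarrow>us. pairing_word v w) = pairing_word v (hd us) * (\<Prod>w\<leftarrow>tl us. pairing_word v w)"
        by (cases us) auto
    qed
    then show ?thesis by simp
  qed
  also have "\<dots> = form_ext (\<lambda>(p, q). pairing_word u p * pairing_word (shuffle_power v (Suc i)) q) (unshuffle y)"
    by (simp add: Suc.IH[OF assms(2)] shuffle_power_def)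
  also have "\<dots> = pairing_word (shuffle u (shuffle_power v (Suc i))) y"
    by (rule pairing_word_shuffle[OF Suc.prems completed_shuffle_power[OF assms(2)], symmetric])
  finally show ?case .
qed

lemma pairing_word_letter_conc:
  assumes "vector_space s" "is_basis s UNIV B" "z \<in> dual_space s" "u \<in> completed_tensor_alg B"
  shows "pairing_word (letter_conc s B x u) (z # y) = z x * pairing_word u y"
proof -
  interpret vector_space s by fact
  from assms(2) have B: "independent B" "span B = UNIV" by (auto simp: is_basis_def)
  interpret Z: module_hom s "(*)" z
    using assms(3) by (simp add: dual_space_def Vector_Spaces.linear_def)
  define S where "S = {b. representation B x b \<noteq> 0}"
  define A where "A = {w. length w \<le> length y \<and> u w \<noteq> 0}"
  have fin: "finite S" "finite A"
    using finite_representation completed_finite_le[OF assms(4)] by (auto simp: S_def A_def)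
  have "pairing_word (letter_conc s B x u) (z # y) =
      (\<Sum>w\<in>(\<lambda>(b, w). b # w) ` (S \<times> A). letter_conc s B x u w * word_pairing w (z # y))"
  proof (rule pairing_word_superset)
    fix w assume "length w = length (z # y)" "letter_conc s B x u w \<noteq> 0"
    then show "w \<in> (\<lambda>(b, w). b # w) ` (S \<times> A)"
      by (cases w) (auto simp: S_def A_def)
  qed (use fin in simp)
  also have "\<dots> = (\<Sum>(b, w)\<in>S \<times> A. (representation B x b * z b) * (u w * word_pairing w y))"
    by (subst sum.reindex) (auto simp: inj_on_def case_prod_unfold mult_ac)
  also have "\<dots> = (\<Sum>b\<in>S. representation B x b * z b) * (\<Sum>w\<in>A. u w * word_pairing w y)"
    by (simp add: sum_product sum.cartesian_product)
  also have "(\<Sum>w\<in>A. u w * word_pairing w y) = pairing_word u y"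
    using fin by (intro pairing_word_superset[symmetric]) (auto simp: A_def)
  also have "(\<Sum>b\<in>S. representation B x b * z b) = z (\<Sum>b\<in>S. s (representation B x b) b)"
    by (simp add: Z.sum Z.scale)
  also have "(\<Sum>b\<in>S. s (representation B x b) b) = x"
    unfolding S_def using B by (intro sum_nonzero_representation_eq) auto
  finally show ?thesis .
qed


section \<open>Characters\<close>

text \<open>The value at a monomial of the character that takes the values \<open>\<phi>\<close> on words.\<close>

definition monomial_value :: "('w list \<Rightarrow> 'k) \<Rightarrow> 'w list multiset \<Rightarrow> 'k::field" where
  "monomial_value \<phi> M = (\<Prod>w\<in>#M. \<phi> w)"

lemma monomial_value_simps [simp]:
  "monomial_value \<phi> 0 = 1" "monomial_value \<phi> {#} = 1"
  "monomial_value \<phi> (add_mset w M) = \<phi> w * monomial_value \<phi> M"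
  "monomial_value \<phi> (M + N) = monomial_value \<phi> M * monomial_value \<phi> N"
  "monomial_value \<phi> (mset ws) = (\<Prod>w\<leftarrow>ws. \<phi> w)"
  by (simp_all add: monomial_value_def prod_mset_prod_list flip: mset_map)

lemma sym_alg_single_iff [simp]:
  "Poly_Mapping.single M c \<in> sym_alg B \<longleftrightarrow> c = 0 \<or> set_mset M \<subseteq> lists B"
  by (auto simp: sym_alg_def)

lemma tensor_incl_in_sym_alg: "p \<in> tensor_alg B \<Longrightarrow> tensor_incl p \<in> sym_alg B"
  unfolding tensor_incl_def sym_alg_def tensor_alg_def
  using keys_lin_ext[of "\<lambda>w. basis_vec {#w#}" p] by fastforce

lemma sym_alg_add: "P \<in> sym_alg B \<Longrightarrow> Q \<in> sym_alg B \<Longrightarrow> P + Q \<in> sym_alg B"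
  unfolding sym_alg_def using keys_add[of P Q] by fastforce

lemma sym_alg_scale: "P \<in> sym_alg B \<Longrightarrow> scale_pm c P \<in> sym_alg B"
  unfolding sym_alg_def using keys_scale_pm[of c P] by fastforce

lemma sym_alg_times:
  assumes "P \<in> sym_alg B" "Q \<in> sym_alg B"
  shows "P * Q \<in> sym_alg B"
  unfolding sym_alg_def
proof (intro CollectI ballI)
  fix M assume "M \<in> Poly_Mapping.keys (P * Q)"
  then obtain M1 M2 where "M1 \<in> Poly_Mapping.keys P" "M2 \<in> Poly_Mapping.keys Q" "M = M1 + M2"
    using keys_mult[of P Q] by blast
  then show "set_mset M \<subseteq> lists B" using assms by (auto simp: sym_alg_def)
qed

lemma form_ext_monomial_value_character:
  "restrict (form_ext (monomial_value \<phi>)) (sym_alg B) \<in> characters B"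
proof -
  have "(basis_vec 0 :: _ \<Rightarrow>\<^sub>0 'b) \<in> sym_alg B" "form_ext (monomial_value \<phi>) (basis_vec 0) = 1"
    by (simp_all del: single_one)
  then show ?thesis
    by (simp add: characters_def sym_alg_add sym_alg_scale sym_alg_times form_ext_times)
qed

text \<open>The words generate the symmetric algebra, so a character is determined by its values on them.\<close>

lemma character_eq_form_ext:
  assumes h: "h \<in> characters B" and val: "\<And>w. w \<in> lists B \<Longrightarrow> h (basis_vec {#w#}) = \<phi> w"
  shows "h = restrict (form_ext (monomial_value \<phi>)) (sym_alg B)"
proof
  fix P
  have ext: "h \<in> extensional (sym_alg B)" and one: "h 1 = 1"
    and add: "h (P + Q) = h P + h Q" and mult: "h (P * Q) = h P * h Q"
    and scale: "h (scale_pm c P) = c * h P"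
    if "P \<in> sym_alg B" "Q \<in> sym_alg B" for P Q c
    using h that by (auto simp: characters_def)
  have mono: "h (basis_vec M) = monomial_value \<phi> M" if "set_mset M \<subseteq> lists B" for M
    using that
  proof (induction M)
    case empty
    show ?case using h by (simp add: characters_def flip: single_one)
  next
    case (add w M)
    have "basis_vec (add_mset w M) = (basis_vec {#w#} * basis_vec M :: _ \<Rightarrow>\<^sub>0 'b)"
      by (simp add: mult_single)
    then show ?case using add mult[of "basis_vec {#w#}" "basis_vec M"] val[of w] by simp
  qed
  show "h P = restrict (form_ext (monomial_value \<phi>)) (sym_alg B) P"
  proof (cases "P \<in> sym_alg B")
    case True
    have "(\<Sum>M\<in>A. Poly_Mapping.single M (c M)) \<in> sym_alg B \<and>
        h (\<Sum>M\<in>A. Poly_Mapping.single M (c M)) = (\<Sum>M\<in>A. c M * monomial_value \<phi> M)"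
      if "finite A" "\<forall>M\<in>A. set_mset M \<subseteq> lists B" for A c
      using that
    proof (induction A rule: finite_induct)
      case empty
      have "(0 :: _ \<Rightarrow>\<^sub>0 'b) \<in> sym_alg B" by (simp add: sym_alg_def)
      with scale[of 0 0 0] show ?case by (simp add: scale_pm_zero)
    next
      case (insert M A)
      have single: "Poly_Mapping.single M (c M) = scale_pm (c M) (basis_vec M)"
        by (rule poly_mapping_eqI) (simp add: lookup_single when_def)
      have "basis_vec M \<in> sym_alg B" using insert by simp
      then have "h (Poly_Mapping.single M (c M)) = c M * monomial_value \<phi> M"
        using scale[of "basis_vec M"  "basis_vec M" "c M"] mono[of M] insert by (simp add: single)
      moreover have "Poly_Mapping.single M (c M) \<in> sym_alg B" using insert by simp
      ultimately show ?case using insert add by (simp add: sym_alg_add)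
    qed
    from this[of "Poly_Mapping.keys P" "Poly_Mapping.lookup P"] True show ?thesis
      by (simp add: sym_alg_def form_ext_def flip: sum_single_keys)
  next
    case False
    then show ?thesis using h by (simp add: characters_def extensional_def)
  qed
qed

lemma char_of_form_eq:
  "char_of_form B (form_ext \<phi>) = restrict (form_ext (monomial_value \<phi>)) (sym_alg B)"
  unfolding char_of_form_def
proof (rule the_equality)
  have "form_ext (monomial_value \<phi>) (tensor_incl p) = form_ext \<phi> p" for p
    by (simp add: tensor_incl_def form_ext_lin_ext)
  then show "restrict (form_ext (monomial_value \<phi>)) (sym_alg B) \<in> characters B \<and>
      (\<forall>p\<in>tensor_alg B. restrict (form_ext (monomial_value \<phi>)) (sym_alg B) (tensor_incl p) = form_ext \<phi> p)"
    by (simp add: form_ext_monomial_value_character tensor_incl_in_sym_alg)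
next
  fix h :: "('a list multiset \<Rightarrow>\<^sub>0 'b) \<Rightarrow> 'b"
  assume h: "h \<in> characters B \<and> (\<forall>p\<in>tensor_alg B. h (tensor_incl p) = form_ext \<phi> p)"
  show "h = restrict (form_ext (monomial_value \<phi>)) (sym_alg B)"
  proof (rule character_eq_form_ext)
    fix w assume "w \<in> lists B"
    then have "(basis_vec w :: _ \<Rightarrow>\<^sub>0 'b) \<in> tensor_alg B" by (simp add: tensor_alg_def)
    with h show "h (basis_vec {#w#}) = \<phi> w"
      by (auto simp: tensor_incl_def dest!: bspec)
  qed (use h in blast)
qed

section \<open>Convolution of characters\<close>

text \<open>A \<^const>\<open>restrict\<close>ed character has an unspecified value on monomials with letters outside the basis.
  Before characters are applied to a coproduct, it must be known that only letters of the basis occur in it.\<close>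

lemma keys_unshuffle_lists:
  "(a, b) \<in> Poly_Mapping.keys (unshuffle w :: _ \<Rightarrow>\<^sub>0 'k::field) \<Longrightarrow> w \<in> lists B \<Longrightarrow>
     a \<in> lists B \<and> b \<in> lists B"
proof (induction w arbitrary: a b)
  case (Cons y w)
  from Cons.prems(1) obtain a' b' where ab: "(a', b') \<in> Poly_Mapping.keys (unshuffle w :: _ \<Rightarrow>\<^sub>0 'k)"
    and x: "(a, b) \<in> Poly_Mapping.keys (basis_vec (y # a', b') + basis_vec (a', y # b') :: _ \<Rightarrow>\<^sub>0 'k)"
    using keys_lin_ext by fastforce
  from x have "(a, b) = (y # a', b') \<or> (a, b) = (a', y # b')"
    using keys_add by fastforce
  with Cons.IH[OF ab] Cons.prems(2) show ?case by auto
qed simp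

lemma keys_iter_unshuffle_lists:
  "us \<in> Poly_Mapping.keys (iter_unshuffle i w :: _ \<Rightarrow>\<^sub>0 'k::field) \<Longrightarrow> w \<in> lists B \<Longrightarrow>
     us \<in> lists (lists B)"
proof (induction i arbitrary: w us)
  case (Suc i)
  from Suc.prems(1) obtain a b where
      ab: "(a, b) \<in> Poly_Mapping.keys (unshuffle w :: _ \<Rightarrow>\<^sub>0 'k)"
    and "us \<in> Poly_Mapping.keys
      (lin_ext (\<lambda>us. basis_vec (a # us)) (iter_unshuffle i b) :: _ \<Rightarrow>\<^sub>0 'k)"
    using keys_lin_ext by (fastforce simp: case_prod_unfold)
  then obtain vs where
      "vs \<in> Poly_Mapping.keys (iter_unshuffle i b :: _ \<Rightarrow>\<^sub>0 'k)" and "us = a # vs"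
    using keys_lin_ext by fastforce
  with Suc.IH[of vs b] keys_unshuffle_lists[OF ab Suc.prems(2)] show ?case by auto
qed simp

lemma keys_tensor_basis_vec:
  "Poly_Mapping.keys (tensor_pm p (basis_vec M)) = (\<lambda>a. (a, M)) ` Poly_Mapping.keys p"
  by (auto simp: in_keys_iff lookup_tensor_basis_vec when_def split: if_splits)

lemma keys_Sum_any:
  "x \<in> Poly_Mapping.keys (Sum_any P) \<Longrightarrow> \<exists>i. x \<in> Poly_Mapping.keys (P i)"
  unfolding Sum_any.expand_set in_keys_iff lookup_sum
  using sum.not_neutral_contains_not_neutral by blast

lemma keys_delta_tilde:
  fixes s :: "'k::field \<Rightarrow> 'w::ab_group_add \<Rightarrow> 'w"
  assumes vs: "vector_space s"
  shows "(a, M) \<in> Poly_Mapping.keys (delta_tilde s B g w) \<Longrightarrow> w \<in> lists B \<Longrightarrow>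
    a \<in> lists B \<and> set_mset M \<subseteq> lists B"
proof (induction "length w" arbitrary: w a M rule: less_induct)
  case less
  interpret vector_space s by fact
  show ?case
  proof (cases w)
    case Nil
    with less.prems show ?thesis by simp
  next
    case (Cons y w')
    with less.prems(1) obtain i a1 M1 where
      1: "(a1, M1) \<in> Poly_Mapping.keys (lin_ext (\<lambda>((a, M), us). basis_vec (a, M + mset us))
            (lin_ext (\<lambda>ws. tensor_pm (delta_tilde s B g (hd ws)) (basis_vec (tl ws)))
               (iter_unshuffle i w')))"
      "(a, M) \<in> Poly_Mapping.keys (tensor_pm (theta s B ((g ^^ i) y) a1) (basis_vec M1))"
      using keys_lin_ext by (fastforce dest!: keys_Sum_any)
    then obtain a2 M2 us where
      2: "((a2, M2), us) \<in> Poly_Mapping.keys (lin_ext (\<lambda>ws. tensor_pm (delta_tilde s B g (hd ws)) (basis_vec (tl ws)))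
               (iter_unshuffle i w'))" "a1 = a2" "M1 = M2 + mset us"
      using keys_lin_ext by fastforce
    then obtain ws where
      3: "ws \<in> Poly_Mapping.keys (iter_unshuffle i w' :: _ \<Rightarrow>\<^sub>0 'k)"
         "((a2, M2), us) \<in> Poly_Mapping.keys (tensor_pm (delta_tilde s B g (hd ws)) (basis_vec (tl ws)))"
      using keys_lin_ext by fastforce
    from 3(2) have 4: "(a2, M2) \<in> Poly_Mapping.keys (delta_tilde s B g (hd ws))" "us = tl ws"
      by (auto simp: keys_tensor_basis_vec)
    have w': "w' \<in> lists B" using less.prems(2) Cons by simp
    from keys_iter_unshuffle[OF 3(1)] have ws: "ws \<noteq> []" "\<forall>u\<in>set ws. length u \<le> length w'" by auto
    from keys_iter_unshuffle_lists[OF 3(1) w'] have wsB: "set ws \<subseteq> lists B" by auto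
    have hd: "hd ws \<in> set ws" using ws(1) by simp
    have "a2 \<in> lists B \<and> set_mset M2 \<subseteq> lists B"
      using less.hyps[OF _ 4(1)] ws(2) subsetD[OF wsB hd] hd Cons by (auto simp: less_Suc_eq_le)
    moreover have "set us \<subseteq> lists B" using 4 wsB ws by (cases ws) auto
    moreover have "M = M1" "a \<in> Poly_Mapping.keys (theta s B ((g ^^ i) y) a1)"
      using 1(2) by (auto simp: keys_tensor_basis_vec)
    moreover from this(2) obtain b where "a = b # a1" "b \<in> B"
      using representation_ne_zero
      by (auto simp: in_keys_iff lookup_theta[OF vs] when_def split: list.splits if_splits)
    ultimately show ?thesis using 2 by auto
  qed
qed

text \<open>The form \<open>\<phi> \<otimes> \<psi>\<close> on \<open>T(W) \<otimes> S(T(W))\<close>, where \<open>\<psi>\<close> is extended from words to a character.\<close>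

definition coprod_value ::
    "('w list \<Rightarrow> 'k) \<Rightarrow> ('w list \<Rightarrow> 'k) \<Rightarrow> ('w list \<times> 'w list multiset \<Rightarrow>\<^sub>0 'k) \<Rightarrow> 'k::field" where
  "coprod_value \<phi> \<psi> = form_ext (\<lambda>(a, M). \<phi> a * monomial_value \<psi> M)"

text \<open>Both the coproduct and the tensor product of two characters are multiplicative, so
  the convolution is the character whose value on a word is read off from the coproduct of this word.\<close>

lemma convolution_char_of_form:
  assumes vs: "vector_space s"
  shows "convolution s B g (char_of_form B (form_ext \<phi>)) (char_of_form B (form_ext \<psi>)) =
    restrict (form_ext (monomial_value (\<lambda>w. coprod_value \<phi> \<psi> (delta_tilde s B g w) + \<psi> w))) (sym_alg B)"
proof -
  let ?\<Phi> = "\<lambda>(M, N). monomial_value \<phi> M * monomial_value \<psi> N"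
  define \<mu> where "\<mu> = restrict (form_ext (monomial_value \<phi>)) (sym_alg B)"
  define \<nu> where "\<nu> = restrict (form_ext (monomial_value \<psi>)) (sym_alg B)"
  have keys: "set_mset X \<subseteq> lists B \<and> set_mset Y \<subseteq> lists B"
    if "(X, Y) \<in> Poly_Mapping.keys (\<Prod>w\<in>#M. coprod_word s B g w)" "set_mset M \<subseteq> lists B" for X Y M
    using that
  proof (induction M arbitrary: X Y)
    case empty
    then show ?case by (simp add: zero_prod_def)
  next
    case (add w M)
    from add.prems(1) obtain X1 Y1 X2 Y2 where
      XY: "(X1, Y1) \<in> Poly_Mapping.keys (coprod_word s B g w)"
        "(X2, Y2) \<in> Poly_Mapping.keys (\<Prod>w\<in>#M. coprod_word s B g w)" "X = X1 + X2" "Y = Y1 + Y2"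
      using keys_mult by fastforce
    have "set_mset X1 \<subseteq> lists B \<and> set_mset Y1 \<subseteq> lists B"
    proof -
      from XY(1) consider "(X1, Y1) = (0, {#w#})" |
        "(X1, Y1) \<in> Poly_Mapping.keys (lin_ext (\<lambda>(a, M). basis_vec ({#a#}, M)) (delta_tilde s B g w))"
        unfolding coprod_word_def using keys_add by fastforce
      then show ?thesis
      proof cases
        case 2
        then obtain a where "(a, Y1) \<in> Poly_Mapping.keys (delta_tilde s B g w)" "X1 = {#a#}"
          using keys_lin_ext by fastforce
        with keys_delta_tilde[OF vs this(1)] add.prems(2) show ?thesis by auto
      qed (use add.prems in auto)
    qed
    with add.IH[OF XY(2)] add.prems(2) XY(3,4) show ?case by auto
  qed
  have mult: "?\<Phi> (x + y) = ?\<Phi> x * ?\<Phi> y" for x y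
    by (cases x; cases y) simp
  have one: "?\<Phi> 0 = 1" by (simp add: zero_prod_def)
  have word: "form_ext ?\<Phi> (coprod_word s B g w) = coprod_value \<phi> \<psi> (delta_tilde s B g w) + \<psi> w" for w
    by (simp add: coprod_word_def form_ext_lin_ext coprod_value_def case_prod_unfold)
  have "tensor_form \<mu> \<nu> (coprod s B g P) =
      form_ext (monomial_value (\<lambda>w. coprod_value \<phi> \<psi> (delta_tilde s B g w) + \<psi> w)) P"
    if P: "P \<in> sym_alg B" for P
  proof -
    have "tensor_form \<mu> \<nu> (coprod s B g P) =
        form_ext (\<lambda>(M, N). \<mu> (basis_vec M) * \<nu> (basis_vec N)) (coprod s B g P)"
      by (simp add: tensor_form_def form_ext_def case_prod_unfold)
    also have "\<dots> = form_ext ?\<Phi> (coprod s B g P)"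
    proof (intro form_ext_cong, clarify)
      fix X Y assume "(X, Y) \<in> Poly_Mapping.keys (coprod s B g P)"
      then obtain M where "M \<in> Poly_Mapping.keys P"
        "(X, Y) \<in> Poly_Mapping.keys (\<Prod>w\<in>#M. coprod_word s B g w)"
        unfolding coprod_def using keys_lin_ext by fastforce
      with keys[OF this(2)] P show "\<mu> (basis_vec X) * \<nu> (basis_vec Y) = monomial_value \<phi> X * monomial_value \<psi> Y"
        by (auto simp: \<mu>_def \<nu>_def sym_alg_def)
    qed
    also have "\<dots> = form_ext (monomial_value (\<lambda>w. coprod_value \<phi> \<psi> (delta_tilde s B g w) + \<psi> w)) P"
      by (simp add: coprod_def form_ext_lin_ext form_ext_prod_mset[OF mult one] word
          monomial_value_def[of "\<lambda>w. coprod_value \<phi> \<psi> (delta_tilde s B g w) + \<psi> w", abs_def])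
    finally show ?thesis .
  qed
  then show ?thesis
    by (auto simp: convolution_def char_of_form_eq restrict_def fun_eq_iff \<mu>_def \<nu>_def)
qed


section \<open>The composition as a continuous linear map\<close>

text \<open>The composition of a word with \<open>v\<close>. The parameter \<open>N\<close> stands for an exponent with \<open>f\<^sup>N = 0\<close>, which
  makes the series over \<open>i\<close> a finite sum.\<close>

definition tilde_word ::
    "('k::field \<Rightarrow> 'v::ab_group_add \<Rightarrow> 'v) \<Rightarrow> 'v set \<Rightarrow> ('v \<Rightarrow> 'v) \<Rightarrow> nat \<Rightarrow> ('v list \<Rightarrow> 'k) \<Rightarrow> 'v list
       \<Rightarrow> 'v list \<Rightarrow> 'k" where
  "tilde_word s B f N v w = rec_list empty_word
     (\<lambda>b _ t. \<Sum>i<N. letter_conc s B ((f ^^ i) b) (shuffle t (shuffle_power v i))) w"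

lemma tilde_word_simps [simp]:
  "tilde_word s B f N v [] = empty_word"
  "tilde_word s B f N v (b # w) =
     (\<Sum>i<N. letter_conc s B ((f ^^ i) b) (shuffle (tilde_word s B f N v w) (shuffle_power v i)))"
  by (simp_all add: tilde_word_def)

text \<open>The cut-off at \<open>\<bar>x\<bar>\<close> drops only zero terms, by the next lemma, and makes the sum finite.\<close>

definition tilde_comp ::
    "('k::field \<Rightarrow> 'v::ab_group_add \<Rightarrow> 'v) \<Rightarrow> 'v set \<Rightarrow> ('v \<Rightarrow> 'v) \<Rightarrow> nat \<Rightarrow> ('v list \<Rightarrow> 'k) \<Rightarrow> ('v list \<Rightarrow> 'k)
       \<Rightarrow> 'v list \<Rightarrow> 'k" where
  "tilde_comp s B f N u v =
     (\<lambda>x. \<Sum>w | length w \<le> length x \<and> u w \<noteq> 0. u w * tilde_word s B f N v w x)"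

lemma tilde_word_length:
  "tilde_word s B f N v w x \<noteq> 0 \<Longrightarrow> length w \<le> length x"
proof (induction w arbitrary: x)
  case (Cons b w)
  from Cons.prems have "(\<Sum>i<N. letter_conc s B ((f ^^ i) b)
      (shuffle (tilde_word s B f N v w) (shuffle_power v i)) x) \<noteq> 0"
    by (simp add: sum_fun_apply)
  from sum.not_neutral_contains_not_neutral[OF this] obtain i where
    "letter_conc s B ((f ^^ i) b) (shuffle (tilde_word s B f N v w) (shuffle_power v i)) x \<noteq> 0"
    by blast
  then obtain c x' where x: "x = c # x'" "shuffle (tilde_word s B f N v w) (shuffle_power v i) x' \<noteq> 0"
    by (cases x) auto
  from x(2) obtain a d where "x' \<in># shuffle_words a d" "tilde_word s B f N v w a \<noteq> 0"
    by (rule shuffle_neq_0D)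
  with Cons.IH[of a] length_set_shuffle_words[of x' a d] x(1) show ?case by auto
qed simp

lemma tilde_word_completed:
  assumes "vector_space s" "v \<in> completed_tensor_alg B"
  shows "tilde_word s B f N v w \<in> completed_tensor_alg B"
  by (induction w)
    (auto intro!: completed_sum completed_letter_conc completed_shuffle completed_shuffle_power assms)

lemma tilde_comp_superset:
  assumes "finite A" "\<And>w. length w \<le> length x \<Longrightarrow> u w \<noteq> 0 \<Longrightarrow> w \<in> A"
  shows "tilde_comp s B f N u v x = (\<Sum>w\<in>A. u w * tilde_word s B f N v w x)"
  unfolding tilde_comp_def using assms tilde_word_length[of s B f N v _ x]
  by (intro sum.mono_neutral_left) auto

lemma tilde_comp_completed:
  assumes "vector_space s" "u \<in> completed_tensor_alg B" "v \<in> completed_tensor_alg B"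
  shows "tilde_comp s B f N u v \<in> completed_tensor_alg B"
proof (rule completedI)
  let ?A = "\<lambda>n. \<Union>w\<in>{w. length w \<le> n \<and> u w \<noteq> 0}. {x. length x \<le> n \<and> tilde_word s B f N v w x \<noteq> 0}"
  show "finite (?A n)" for n
    by (intro finite_UN_I completed_finite_le[OF assms(2)]
        completed_finite_le[OF tilde_word_completed[OF assms(1,3)]])
  fix x assume "tilde_comp s B f N u v x \<noteq> 0"
  from sum.not_neutral_contains_not_neutral[OF this[unfolded tilde_comp_def]]
  obtain w where w: "length w \<le> length x" "u w \<noteq> 0" "tilde_word s B f N v w x \<noteq> 0"
    by auto
  then show "x \<in> lists B" using tilde_word_completed[OF assms(1,3)] completedD by blast
  show "x \<in> ?A (length x)" using w by auto
qed

lemma tilde_comp_add: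
  assumes "u \<in> completed_tensor_alg B" "u' \<in> completed_tensor_alg B"
  shows "tilde_comp s B f N (u + u') v = tilde_comp s B f N u v + tilde_comp s B f N u' v"
proof
  fix x :: "'a list"
  define A where "A = {w. length w \<le> length x \<and> u w \<noteq> 0} \<union> {w. length w \<le> length x \<and> u' w \<noteq> 0}"
  have A: "finite A" unfolding A_def using assms completed_finite_le by blast
  have "tilde_comp s B f N t v x = (\<Sum>w\<in>A. t w * tilde_word s B f N v w x)"
    if "t = u \<or> t = u' \<or> t = u + u'" for t
    using that by (intro tilde_comp_superset A) (auto simp: A_def)
  then show "tilde_comp s B f N (u + u') v x = (tilde_comp s B f N u v + tilde_comp s B f N u' v) x"
    by (simp add: algebra_simps sum.distrib)
qed

lemma tilde_comp_scale:
  assumes "u \<in> completed_tensor_alg B"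
  shows "tilde_comp s B f N (fun_scale c u) v = fun_scale c (tilde_comp s B f N u v)"
proof
  fix x :: "'a list"
  define A where "A = {w. length w \<le> length x \<and> u w \<noteq> 0}"
  have A: "finite A" unfolding A_def using assms completed_finite_le by blast
  have "tilde_comp s B f N t v x = (\<Sum>w\<in>A. t w * tilde_word s B f N v w x)"
    if "t = u \<or> t = fun_scale c u" for t
    using that by (intro tilde_comp_superset A) (auto simp: A_def fun_scale_def)
  then show "tilde_comp s B f N (fun_scale c u) v x = fun_scale c (tilde_comp s B f N u v) x"
    by (simp add: fun_scale_def sum_distrib_left mult_ac)
qed

lemma tilde_comp_empty_word: "tilde_comp s B f N empty_word v = empty_word"
proof
  fix x
  have "tilde_comp s B f N empty_word v x = (\<Sum>w\<in>{[]}. empty_word w * tilde_word s B f N v w x)"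
    by (rule tilde_comp_superset) (auto simp: empty_word_def split: if_splits)
  then show "tilde_comp s B f N empty_word v x = empty_word x" by (simp add: empty_word_def)
qed

lemma representation_linear:
  assumes "vector_space s" "Vector_Spaces.linear s s h" "is_basis s UNIV B"
  shows "module.representation s B (h x) c =
    (\<Sum>b | module.representation s B x b \<noteq> 0.
      module.representation s B x b * module.representation s B (h b) c)"
proof -
  interpret vector_space s by fact
  interpret h: module_hom s s h using assms(2) by (simp add: Vector_Spaces.linear_def)
  from assms(3) have B: "independent B" "span B = UNIV" by (auto simp: is_basis_def)
  have "h x = h (\<Sum>b | representation B x b \<noteq> 0. s (representation B x b) b)"
    using B by (subst sum_nonzero_representation_eq) auto
  also have "\<dots> = (\<Sum>b | representation B x b \<noteq> 0. s (representation B x b) (h b))"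
    by (simp add: h.sum h.scale)
  finally show ?thesis
    using B by (simp add: representation_sum representation_scale)
qed

text \<open>The recursion on words holds for the letters in \<open>B\<close>. For an arbitrary vector \<open>x\<close> it follows by
  expanding \<open>x\<close> in the basis and \<open>u\<close> in words, because each term is linear in both.\<close>

lemma tilde_comp_letter_conc:
  assumes vs: "vector_space s" and lin: "Vector_Spaces.linear s s f" and basis: "is_basis s UNIV B"
    and u: "u \<in> completed_tensor_alg B"
  shows "tilde_comp s B f N (letter_conc s B x u) v =
    (\<Sum>i<N. letter_conc s B ((f ^^ i) x) (shuffle (tilde_comp s B f N u v) (shuffle_power v i)))"
proof
  interpret vector_space s by fact
  fix y
  show "tilde_comp s B f N (letter_conc s B x u) v y =
    (\<Sum>i<N. letter_conc s B ((f ^^ i) x) (shuffle (tilde_comp s B f N u v) (shuffle_power v i))) y"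
  proof (cases y)
    case Nil
    have "tilde_comp s B f N (letter_conc s B x u) v [] =
        (\<Sum>w\<in>{}. letter_conc s B x u w * tilde_word s B f N v w [])"
      by (rule tilde_comp_superset) auto
    then show ?thesis by (simp add: Nil sum_fun_apply)
  next
    case (Cons c y')
    define S where "S = {b. representation B x b \<noteq> 0}"
    define A where "A = {w. length w \<le> length y' \<and> u w \<noteq> 0}"
    define q where "q w i = shuffle (tilde_word s B f N v w) (shuffle_power v i) y'" for w i
    have fin: "finite S" "finite A"
      using finite_representation completed_finite_le[OF u] by (auto simp: S_def A_def)
    have q: "shuffle (tilde_comp s B f N u v) (shuffle_power v i) y' = (\<Sum>w\<in>A. u w * q w i)" for i
      unfolding q_def using fin
      by (intro shuffle_sum_left tilde_comp_superset) (auto simp: A_def)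
    have "tilde_comp s B f N (letter_conc s B x u) v y =
        (\<Sum>w\<in>(\<lambda>(b, w). b # w) ` (S \<times> A). letter_conc s B x u w * tilde_word s B f N v w y)"
    proof (rule tilde_comp_superset)
      fix w assume "length w \<le> length y" "letter_conc s B x u w \<noteq> 0"
      then show "w \<in> (\<lambda>(b, w). b # w) ` (S \<times> A)"
        by (cases w) (auto simp: S_def A_def Cons)
    qed (use fin in simp)
    also have "\<dots> = (\<Sum>(b, w)\<in>S \<times> A. \<Sum>i<N.
        (representation B x b * representation B ((f ^^ i) b) c) * (u w * q w i))"
      by (subst sum.reindex)
        (auto simp: inj_on_def case_prod_unfold Cons sum_fun_apply sum_distrib_left q_def mult_ac)
    also have "\<dots> = (\<Sum>i<N. \<Sum>(b, w)\<in>S \<times> A.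
        (representation B x b * representation B ((f ^^ i) b) c) * (u w * q w i))"
      by (simp add: case_prod_unfold sum.swap[of _ "{..<N}"])
    also have "\<dots> = (\<Sum>i<N. representation B ((f ^^ i) x) c * (\<Sum>w\<in>A. u w * q w i))"
      by (simp add: representation_linear[OF vs linear_funpow[OF vs lin] basis, of _ x c] S_def
          sum_product sum.cartesian_product)
    finally show ?thesis by (simp add: Cons sum_fun_apply q)
  qed
qed

lemma topspace_tensor_topology [simp]: "topspace (tensor_topology B) = completed_tensor_alg B"
  unfolding tensor_topology_def
  by (rule Metric_space.topspace_mtopology[OF Metric_space_word_dist])

lemma half_power_less:
  assumes "\<epsilon> > (0 :: real)"
  obtains n where "(1 / 2) ^ n < \<epsilon>"
  using real_arch_pow_inv[of \<epsilon> "1 / 2"] assms by auto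

text \<open>The balls of the ultrametric are given by agreement on words up to some length.\<close>

lemma continuous_tensor_topology_iff:
  fixes F :: "('v list \<Rightarrow> 'k::field) \<Rightarrow> 'v list \<Rightarrow> 'k"
  shows "continuous_map (tensor_topology B) (tensor_topology B) F \<longleftrightarrow>
    F ` completed_tensor_alg B \<subseteq> completed_tensor_alg B \<and>
    (\<forall>u\<in>completed_tensor_alg B. \<forall>n. \<exists>m. \<forall>u'\<in>completed_tensor_alg B.
      (\<forall>w. length w \<le> m \<longrightarrow> u w = u' w) \<longrightarrow> (\<forall>w. length w \<le> n \<longrightarrow> F u w = F u' w))"
proof -
  interpret C: Metric_space "completed_tensor_alg B :: ('v list \<Rightarrow> 'k) set" word_dist
    by (rule Metric_space_word_dist)
  have "(\<forall>\<epsilon>>0. \<exists>\<delta>>0. \<forall>u'. u' \<in> completed_tensor_alg B \<and> word_dist u u' < \<delta> \<longrightarrow> word_dist (F u) (F u') < \<epsilon>) \<longleftrightarrow>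
    (\<forall>n. \<exists>m. \<forall>u'\<in>completed_tensor_alg B.
      (\<forall>w. length w \<le> m \<longrightarrow> u w = u' w) \<longrightarrow> (\<forall>w. length w \<le> n \<longrightarrow> F u w = F u' w))" (is "?L \<longleftrightarrow> ?R") for u
  proof
    assume L: ?L
    show ?R
    proof
      fix n
      have "(1 / 2 :: real) ^ n > 0" by simp
      with L obtain \<delta> where "\<delta> > 0" and
        \<delta>: "\<And>u'. u' \<in> completed_tensor_alg B \<Longrightarrow> word_dist u u' < \<delta> \<Longrightarrow> word_dist (F u) (F u') < (1 / 2) ^ n"
        by meson
      from half_power_less[OF \<open>\<delta> > 0\<close>] obtain m where m: "(1 / 2) ^ m < \<delta>" .
      show "\<exists>m. \<forall>u'\<in>completed_tensor_alg B.
        (\<forall>w. length w \<le> m \<longrightarrow> u w = u' w) \<longrightarrow> (\<forall>w. length w \<le> n \<longrightarrow> F u w = F u' w)"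
        unfolding word_dist_less_iff[symmetric]
        using order.strict_trans[OF _ m] \<delta> by blast
    qed
  next
    assume R: ?R
    show ?L
    proof (intro allI impI)
      fix \<epsilon> :: real assume "\<epsilon> > 0"
      from half_power_less[OF this] obtain n where n: "(1 / 2) ^ n < \<epsilon>" .
      from R obtain m where m: "\<And>u'. u' \<in> completed_tensor_alg B \<Longrightarrow>
        (\<forall>w. length w \<le> m \<longrightarrow> u w = u' w) \<Longrightarrow> (\<forall>w. length w \<le> n \<longrightarrow> F u w = F u' w)" by meson
      have "word_dist (F u) (F u') < \<epsilon>"
        if "u' \<in> completed_tensor_alg B" "word_dist u u' < (1 / 2) ^ m" for u'
        using m[unfolded word_dist_less_iff[symmetric], OF that] n by (rule order.strict_trans)
      moreover have "(1 / 2 :: real) ^ m > 0" by simp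
      ultimately show "\<exists>\<delta>>0. \<forall>u'. u' \<in> completed_tensor_alg B \<and> word_dist u u' < \<delta> \<longrightarrow> word_dist (F u) (F u') < \<epsilon>"
        by blast
    qed
  qed
  then show ?thesis
    unfolding tensor_topology_def C.metric_continuous_map[OF Metric_space_word_dist] by simp
qed

lemma tilde_comp_cong:
  assumes "\<And>w. length w \<le> length x \<Longrightarrow> u w = u' w"
  shows "tilde_comp s B f N u v x = tilde_comp s B f N u' v x"
  unfolding tilde_comp_def using assms by (intro sum.cong) auto

text \<open>The partial sums are constant from \<open>N\<close> on, and limits are unique in a metric space.
  This turns the limit that characterises the composition into an equation.\<close>

lemma letter_series_limit_iff:
  assumes vs: "vector_space s" and f: "Vector_Spaces.linear s s f" "\<forall>x. (f ^^ N) x = 0"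
    and u: "\<And>i. u i \<in> completed_tensor_alg B"
  shows "limitin (tensor_topology B) (\<lambda>n. \<Sum>i<n. letter_conc s B ((f ^^ i) x) (u i)) t sequentially \<longleftrightarrow>
    t = (\<Sum>i<N. letter_conc s B ((f ^^ i) x) (u i))" (is "?L \<longleftrightarrow> t = ?r")
proof -
  have ev: "eventually (\<lambda>n. (\<Sum>i<n. letter_conc s B ((f ^^ i) x) (u i)) = ?r) sequentially"
    unfolding eventually_sequentially
  proof (intro exI allI impI)
    fix n assume "N \<le> n"
    then show "(\<Sum>i<n. letter_conc s B ((f ^^ i) x) (u i)) = ?r"
      by (intro sum.mono_neutral_right) (auto simp: funpow_zero_mono[OF vs f] letter_conc_0[OF vs])
  qed
  have r: "?r \<in> topspace (tensor_topology B)"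
    using vs u by (auto intro!: completed_sum completed_letter_conc)
  have haus: "Hausdorff_space (tensor_topology B)"
    unfolding tensor_topology_def
    by (rule Metric_space.Hausdorff_space_mtopology[OF Metric_space_word_dist])
  show ?thesis
    using limitin_eventually[OF r ev] limitin_Hausdorff_unique[OF _ _ trivial_limit_sequentially haus]
    by blast
qed

lemma is_tilde_comp_tilde_comp:
  assumes vs: "vector_space s" and f: "Vector_Spaces.linear s s f" "\<forall>x. (f ^^ N) x = 0"
    and basis: "is_basis s UNIV B"
  shows "is_tilde_comp s B f (tilde_comp s B f N)"
  unfolding is_tilde_comp_def
proof (intro conjI ballI allI)
  fix u v :: "'b list \<Rightarrow> 'a"
  assume u: "u \<in> completed_tensor_alg B" and v: "v \<in> completed_tensor_alg B"
  show "tilde_comp s B f N u v \<in> completed_tensor_alg B"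
    using vs u v by (rule tilde_comp_completed)
next
  fix u u' v :: "'b list \<Rightarrow> 'a"
  assume "u \<in> completed_tensor_alg B" "u' \<in> completed_tensor_alg B"
  then show "tilde_comp s B f N (u + u') v = tilde_comp s B f N u v + tilde_comp s B f N u' v"
    by (rule tilde_comp_add)
next
  fix c and u v :: "'b list \<Rightarrow> 'a"
  assume "u \<in> completed_tensor_alg B"
  then show "tilde_comp s B f N (fun_scale c u) v = fun_scale c (tilde_comp s B f N u v)"
    by (rule tilde_comp_scale)
next
  fix v :: "'b list \<Rightarrow> 'a"
  assume "v \<in> completed_tensor_alg B"
  then show "continuous_map (tensor_topology B) (tensor_topology B) (\<lambda>u. tilde_comp s B f N u v)"
    unfolding continuous_tensor_topology_iff
  proof (intro conjI ballI allI)
    fix u :: "'b list \<Rightarrow> 'a" and n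
    show "\<exists>m. \<forall>u'\<in>completed_tensor_alg B. (\<forall>w. length w \<le> m \<longrightarrow> u w = u' w) \<longrightarrow>
        (\<forall>w. length w \<le> n \<longrightarrow> tilde_comp s B f N u v w = tilde_comp s B f N u' v w)"
      by (intro exI[of _ n]) (auto intro: tilde_comp_cong)
  qed (auto intro: tilde_comp_completed[OF vs])
next
  fix v :: "'b list \<Rightarrow> 'a"
  show "tilde_comp s B f N empty_word v = empty_word" by (rule tilde_comp_empty_word)
next
  fix x and u v :: "'b list \<Rightarrow> 'a"
  assume u: "u \<in> completed_tensor_alg B" and v: "v \<in> completed_tensor_alg B"
  have "shuffle (tilde_comp s B f N u v) (shuffle_power v i) \<in> completed_tensor_alg B" for i
    using vs u v by (intro completed_shuffle completed_shuffle_power tilde_comp_completed)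
  from letter_series_limit_iff[OF vs f this]
  show "limitin (tensor_topology B)
      (\<lambda>n. \<Sum>i<n. letter_conc s B ((f ^^ i) x) (shuffle (tilde_comp s B f N u v) (shuffle_power v i)))
      (tilde_comp s B f N (letter_conc s B x u) v) sequentially"
    using tilde_comp_letter_conc[OF vs f(1) basis u] by simp
qed

section \<open>The composition is dual to the coproduct\<close>

definition word_vec :: "'v list \<Rightarrow> 'v list \<Rightarrow> 'k::field" where
  "word_vec w = (\<lambda>x. if x = w then 1 else 0)"

lemma word_vec_Nil: "word_vec [] = empty_word"
  by (simp add: word_vec_def empty_word_def)

lemma word_vec_Cons:
  assumes "vector_space s" "is_basis s UNIV B" "b \<in> B"
  shows "word_vec (b # w) = letter_conc s B b (word_vec w)"
proof -
  interpret vector_space s by fact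
  have "representation B b = (\<lambda>c. if c = b then 1 else 0)"
    using assms(2,3) by (intro representation_basis) (auto simp: is_basis_def)
  then show ?thesis
    by (auto simp: fun_eq_iff word_vec_def letter_conc_def split: list.split)
qed

lemma word_vec_completed: "w \<in> lists B \<Longrightarrow> word_vec w \<in> completed_tensor_alg B"
  by (rule completedI[where A = "\<lambda>_. {w}"]) (auto simp: word_vec_def split: if_splits)

lemma is_basis_subset:
  assumes "vector_space s" "is_basis s W B"
  shows "B \<subseteq> W"
proof -
  interpret vector_space s by fact
  show ?thesis using assms(2) span_superset by (auto simp: is_basis_def)
qed

text \<open>The pairing with a word starting with \<open>x\<close> turns \<open>\<theta>\<^sub>z\<close> into multiplication by \<open>z(x)\<close>; the expansion
  of \<open>z\<close> in the basis \<open>B'\<close> disappears.\<close>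

lemma form_ext_theta:
  fixes s :: "'k::field \<Rightarrow> 'v::ab_group_add \<Rightarrow> 'v"
  assumes "is_basis fun_scale (dual_space s) B'" "z \<in> dual_space s"
  shows "form_ext (word_pairing (x # w)) (theta fun_scale B' z a) = z x * word_pairing w a"
proof -
  interpret F: vector_space fun_scale by (rule vector_space_fun_scale)
  have "z = (\<Sum>b | F.representation B' z b \<noteq> 0. fun_scale (F.representation B' z b) b)"
    using assms by (intro F.sum_nonzero_representation_eq[symmetric]) (auto simp: is_basis_def)
  then have "z x = (\<Sum>b | F.representation B' z b \<noteq> 0. F.representation B' z b * b x)"
    by (metis (no_types, lifting) fun_scale_def sum.cong sum_fun_apply)
  then show ?thesis
    by (simp add: theta_def form_ext_sum sum_distrib_right mult.assoc)
qed

lemma coprod_value_sum: "coprod_value \<phi> \<psi> (\<Sum>i\<in>I. Z i) = (\<Sum>i\<in>I. coprod_value \<phi> \<psi> (Z i))"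
  by (simp add: coprod_value_def form_ext_sum)

lemma coprod_value_mult: "coprod_value (\<lambda>a. c * \<phi> a) \<psi> Z = c * coprod_value \<phi> \<psi> Z"
  by (simp add: coprod_value_def case_prod_unfold mult.assoc form_ext_mult_left)

text \<open>One term of the recursion for \<open>\<Delta>\<close>-tilde: since \<open>\<psi>\<close> is multiplicative, the map \<open>m\<^sup>(\<^sup>i\<^sup>+\<^sup>1\<^sup>)\<close> becomes a
  product of values.\<close>

lemma coprod_value_delta_tilde_term:
  "coprod_value \<phi> \<psi>
      (lin_ext (\<lambda>(a, M). tensor_pm (theta s B z a) (basis_vec M))
         (lin_ext (\<lambda>((a, M), us). basis_vec (a, M + mset us))
            (lin_ext (\<lambda>ws. tensor_pm (\<delta> (hd ws)) (basis_vec (tl ws))) p))) =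
    form_ext (\<lambda>ws. coprod_value (\<lambda>a. form_ext \<phi> (theta s B z a)) \<psi> (\<delta> (hd ws)) *
      (\<Prod>w\<leftarrow>tl ws. \<psi> w)) p"
  by (simp add: coprod_value_def form_ext_lin_ext form_ext_tensor case_prod_unfold
      form_ext_mult_right mult.assoc flip: form_ext_mult_right)

lemma theta_zero: "vector_space s \<Longrightarrow> theta s B 0 w = 0"
  by (simp add: theta_def module.representation_zero module_iff_vector_space)

lemma coprod_value_delta_tilde_Cons:
  assumes vs: "vector_space s" and nil: "\<And>i. N \<le> i \<Longrightarrow> (g ^^ i) z = 0"
  shows "coprod_value \<phi> \<psi> (delta_tilde s B g (z # y)) =
    (\<Sum>i<N. form_ext (\<lambda>ws. coprod_value (\<lambda>a. form_ext \<phi> (theta s B ((g ^^ i) z) a)) \<psi>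
        (delta_tilde s B g (hd ws)) * (\<Prod>w\<leftarrow>tl ws. \<psi> w)) (iter_unshuffle i y))"
proof -
  let ?T = "\<lambda>i. lin_ext (\<lambda>(a, M). tensor_pm (theta s B ((g ^^ i) z) a) (basis_vec M))
         (lin_ext (\<lambda>((a, M), us). basis_vec (a, M + mset us))
            (lin_ext (\<lambda>ws. tensor_pm (delta_tilde s B g (hd ws)) (basis_vec (tl ws)))
               (iter_unshuffle i y)))"
  have "?T i = 0" if "N \<le> i" for i
    using nil[OF that]
    by (simp add: theta_zero[OF vs] tensor_pm_zero_left case_prod_unfold lin_ext_fun_zero)
  then have "{i. ?T i \<noteq> 0} \<subseteq> {..<N}" by (auto simp: not_le[symmetric])
  then have "delta_tilde s B g (z # y) = (\<Sum>i<N. ?T i)"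
    unfolding delta_tilde.simps by (intro Sum_any.expand_superset) auto
  then show ?thesis by (simp only: coprod_value_sum coprod_value_delta_tilde_term)
qed

lemma transpose_map_funpow_zero:
  assumes "vector_space s" "Vector_Spaces.linear s s f" "\<forall>x. (f ^^ N) x = 0" "z \<in> dual_space s" "N \<le> i"
  shows "(transpose_map f ^^ i) z = 0"
proof -
  interpret Z: module_hom s "(*)" z
    using assms(4) by (simp add: dual_space_def Vector_Spaces.linear_def)
  show ?thesis
    using assms by (simp add: transpose_map_funpow fun_eq_iff funpow_zero_mono[where N = N] Z.zero)
qed

text \<open>Induction on \<open>w\<close> with \<open>y\<close> arbitrary: the recursion for \<open>\<Delta>\<close>-tilde\<open>(zy')\<close> uses the values of \<open>\<Delta>\<close>-tilde
  at many subwords of \<open>y'\<close>.\<close>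

lemma pairing_cmp_word:
  fixes s :: "'k::field \<Rightarrow> 'v::ab_group_add \<Rightarrow> 'v"
  assumes vs: "vector_space s" and f: "Vector_Spaces.linear s s f" "\<forall>x. (f ^^ N) x = 0"
    and basis: "is_basis s UNIV B" and basis': "is_basis fun_scale (dual_space s) B'"
    and cmp: "is_tilde_comp s B f cmp" and v: "v \<in> completed_tensor_alg B"
    and "w \<in> lists B" "y \<in> lists B'"
  shows "pairing_word (cmp (word_vec w) v) y =
    coprod_value (word_pairing w) (pairing_word v) (delta_tilde fun_scale B' (transpose_map f) y)"
  using assms(8,9)
proof (induction w arbitrary: y rule: list.induct)
  case Nil
  have c: "cmp (word_vec []) v = word_vec []"
    using cmp v by (simp add: is_tilde_comp_def word_vec_Nil)
  show ?case
  proof (cases y)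
    case Nil
    then show ?thesis unfolding c by (simp add: word_vec_def pairing_word_single coprod_value_def)
  next
    case (Cons z y')
    have z: "z \<in> dual_space s"
      using is_basis_subset[OF vector_space_fun_scale basis'] Nil.prems Cons by auto
    have nil: "(transpose_map f ^^ i) z = 0" if "N \<le> i" for i
      using transpose_map_funpow_zero[OF vs f z that] .
    \<comment> \<open>Every word in the first factor of \<open>\<Delta>\<close>-tilde\<open>(zy')\<close> is nonempty.\<close>
    have "form_ext (word_pairing []) (theta fun_scale B' z' a) = 0" for z' a
      by (simp add: theta_def form_ext_sum)
    then have "coprod_value (word_pairing []) (pairing_word v)
        (delta_tilde fun_scale B' (transpose_map f) (z # y')) = 0"
      by (subst coprod_value_delta_tilde_Cons[OF vector_space_fun_scale nil])
        (simp_all add: coprod_value_def case_prod_unfold form_ext_fun_zero)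
    then show ?thesis
      unfolding c Cons by (simp add: word_vec_def pairing_word_single del: delta_tilde.simps)
  qed
next
  case (Cons x w)
  have wc: "(word_vec w :: 'v list \<Rightarrow> 'k) \<in> completed_tensor_alg B" using Cons.prems by (intro word_vec_completed) simp
  have cc: "cmp (word_vec w) v \<in> completed_tensor_alg B"
    using cmp v wc by (auto simp: is_tilde_comp_def)
  let ?u = "\<lambda>i. shuffle (cmp (word_vec w) v) (shuffle_power v i)"
  have uc: "?u i \<in> completed_tensor_alg B" for i
    using cc v by (intro completed_shuffle completed_shuffle_power)
  have xB: "x \<in> B" using Cons.prems by simp
  have "limitin (tensor_topology B)
      (\<lambda>n. \<Sum>i<n. letter_conc s B ((f ^^ i) x) (?u i)) (cmp (letter_conc s B x (word_vec w)) v) sequentially"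
    using cmp v wc unfolding is_tilde_comp_def by blast
  then have c: "cmp (word_vec (x # w)) v = (\<Sum>i<N. letter_conc s B ((f ^^ i) x) (?u i))"
    using letter_series_limit_iff[OF vs f uc] by (simp add: word_vec_Cons[OF vs basis xB])
  show ?case
  proof (cases y)
    case Nil
    then show ?thesis
      \<comment> \<open>Both sides vanish because nonempty words pair to \<open>0\<close> with \<open>\<emptyset>\<close>.\<close>
      unfolding c by (simp add: pairing_word_def sum_fun_apply coprod_value_def)
  next
    case (Cons z y')
    have z: "z \<in> dual_space s"
      using is_basis_subset[OF vector_space_fun_scale basis'] Cons.prems(2) Cons by auto
    have y': "y' \<in> lists B'" using Cons.prems(2) Cons by simp
    have nil: "(transpose_map f ^^ i) z = 0" if "N \<le> i" for i
      using transpose_map_funpow_zero[OF vs f z that] .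
    have zi: "(transpose_map f ^^ i) z \<in> dual_space s" for i
      using Vector_Spaces.linear_compose[OF linear_funpow[OF vs f(1), of i], of "(*)" z] z
      by (simp add: dual_space_def transpose_map_funpow)
    have "pairing_word (cmp (word_vec (x # w)) v) y =
        pairing_word (\<Sum>i<N. fun_scale 1 (letter_conc s B ((f ^^ i) x) (?u i))) y"
      unfolding c by (simp add: fun_scale_def)
    also have "\<dots> = (\<Sum>i<N. pairing_word (letter_conc s B ((f ^^ i) x) (?u i)) y)"
      using vs uc by (subst pairing_word_sum[where B = B]) (auto intro: completed_letter_conc)
    also have "\<dots> = (\<Sum>i<N. z ((f ^^ i) x) * pairing_word (?u i) y')"
      by (simp add: Cons pairing_word_letter_conc[OF vs basis z uc])
    also have "\<dots> = (\<Sum>i<N. form_ext (\<lambda>ws. coprod_value (\<lambda>a. form_ext (word_pairing (x # w))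
          (theta fun_scale B' ((transpose_map f ^^ i) z) a)) (pairing_word v)
        (delta_tilde fun_scale B' (transpose_map f) (hd ws)) * (\<Prod>w\<leftarrow>tl ws. pairing_word v w)) (iter_unshuffle i y'))"
    proof (intro sum.cong refl)
      fix i
      have "pairing_word (?u i) y' = form_ext (\<lambda>ws. pairing_word (cmp (word_vec w) v) (hd ws) *
          (\<Prod>w\<leftarrow>tl ws. pairing_word v w)) (iter_unshuffle i y')"
        by (rule pairing_word_iter_unshuffle[OF cc v, symmetric])
      also have "\<dots> = form_ext (\<lambda>ws. coprod_value (word_pairing w) (pairing_word v)
          (delta_tilde fun_scale B' (transpose_map f) (hd ws)) *
          (\<Prod>w\<leftarrow>tl ws. pairing_word v w)) (iter_unshuffle i y')"
      proof (rule form_ext_cong)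
        fix ws assume ws: "ws \<in> Poly_Mapping.keys (iter_unshuffle i y' :: _ \<Rightarrow>\<^sub>0 'k)"
        from keys_iter_unshuffle[OF ws] have "ws \<noteq> []" by auto
        with keys_iter_unshuffle_lists[OF ws y'] have "hd ws \<in> lists B'"
          by (metis hd_in_set in_lists_conv_set)
        then show "pairing_word (cmp (word_vec w) v) (hd ws) * (\<Prod>w\<leftarrow>tl ws. pairing_word v w) =
          coprod_value (word_pairing w) (pairing_word v)
          (delta_tilde fun_scale B' (transpose_map f) (hd ws)) * (\<Prod>w\<leftarrow>tl ws. pairing_word v w)"
          using Cons.IH[of "hd ws"] Cons.prems(1) by simp
      qed
      finally show "z ((f ^^ i) x) * pairing_word (?u i) y' =
        form_ext (\<lambda>ws. coprod_value (\<lambda>a. form_ext (word_pairing (x # w))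
          (theta fun_scale B' ((transpose_map f ^^ i) z) a)) (pairing_word v)
        (delta_tilde fun_scale B' (transpose_map f) (hd ws)) * (\<Prod>w\<leftarrow>tl ws. pairing_word v w)) (iter_unshuffle i y')"
        by (simp add: form_ext_theta[OF basis' zi] coprod_value_mult mult.assoc form_ext_mult_left)
          (simp add: transpose_map_funpow)
    qed
    also have "\<dots> = coprod_value (word_pairing (x # w)) (pairing_word v)
        (delta_tilde fun_scale B' (transpose_map f) y)"
      unfolding Cons by (rule coprod_value_delta_tilde_Cons[OF vector_space_fun_scale nil, symmetric])
    finally show ?thesis .
  qed
qed

text \<open>By continuity, words longer than some bound \<open>k\<close> in \<open>u\<close> do not change the components of degree
  at most \<open>\<bar>y\<bar>\<close> of \<open>cmp u v\<close>. This reduces the claim to finite sums of words.\<close>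

lemma pairing_cmp:
  fixes s :: "'k::field \<Rightarrow> 'v::ab_group_add \<Rightarrow> 'v"
  assumes vs: "vector_space s" and f: "Vector_Spaces.linear s s f" "\<forall>x. (f ^^ N) x = 0"
    and basis: "is_basis s UNIV B" and basis': "is_basis fun_scale (dual_space s) B'"
    and cmp: "is_tilde_comp s B f cmp"
    and u: "u \<in> completed_tensor_alg B" and v: "v \<in> completed_tensor_alg B"
    and y: "y \<in> lists B'"
  shows "pairing_word (cmp u v) y =
    coprod_value (pairing_word u) (pairing_word v) (delta_tilde fun_scale B' (transpose_map f) y)"
proof -
  let ?\<Delta> = "delta_tilde fun_scale B' (transpose_map f) y"
  have "continuous_map (tensor_topology B) (tensor_topology B) (\<lambda>u. cmp u v)"
    using cmp v by (simp add: is_tilde_comp_def)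
  then have "\<exists>k. \<forall>u'\<in>completed_tensor_alg B. (\<forall>w. length w \<le> k \<longrightarrow> u w = u' w) \<longrightarrow>
      (\<forall>w. length w \<le> length y \<longrightarrow> cmp u v w = cmp u' v w)"
    unfolding continuous_tensor_topology_iff using u by simp
  then obtain k where k: "\<forall>u'\<in>completed_tensor_alg B. (\<forall>w. length w \<le> k \<longrightarrow> u w = u' w) \<longrightarrow>
      (\<forall>w. length w \<le> length y \<longrightarrow> cmp u v w = cmp u' v w)" ..
  \<comment> \<open>Truncating \<open>u\<close> at length \<open>m\<close> changes neither side.\<close>
  define m where "m = Max (insert k ((\<lambda>(a, M). length a) ` Poly_Mapping.keys ?\<Delta>))"
  have m: "k \<le> m" "(a, M) \<in> Poly_Mapping.keys ?\<Delta> \<Longrightarrow> length a \<le> m" for a M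
    unfolding m_def by (auto intro!: Max_ge rev_image_eqI)
  define A where "A = {w. length w \<le> m \<and> u w \<noteq> 0}"
  have A: "finite A" "A \<subseteq> lists B"
    using completed_finite_le[OF u] completedD[OF u] by (auto simp: A_def)
  define u' where "u' = (\<Sum>w\<in>A. fun_scale (u w) (word_vec w))"
  have wc: "(word_vec w :: 'v list \<Rightarrow> 'k) \<in> completed_tensor_alg B" if "w \<in> A" for w
    using that A by (auto intro: word_vec_completed)
  then have u': "u' \<in> completed_tensor_alg B"
    unfolding u'_def by (intro completed_sum completed_scale)
  have eq: "u w = u' w" if "length w \<le> m" for w
  proof -
    have "u' w = (\<Sum>w'\<in>A. if w = w' then u w' else 0)"
      unfolding u'_def sum_fun_apply by (intro sum.cong) (auto simp: fun_scale_def word_vec_def)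
    then show ?thesis using A that by (auto simp: A_def)
  qed
  have lin: "I \<subseteq> A \<Longrightarrow> cmp (\<Sum>w\<in>I. fun_scale (u w) (word_vec w)) v = (\<Sum>w\<in>I. fun_scale (u w) (cmp (word_vec w) v))"
    if "finite I" for I
    using that
  proof (induction I)
    case empty
    have "cmp (fun_scale 0 0) v = fun_scale 0 (cmp 0 v)"
      using cmp v completed_zero unfolding is_tilde_comp_def by blast
    moreover have "fun_scale 0 t = 0" for t :: "'v list \<Rightarrow> 'k"
      by (simp add: fun_scale_def fun_eq_iff)
    ultimately show ?case by (simp only: sum.empty)
  next
    case (insert w I)
    have w: "(word_vec w :: 'v list \<Rightarrow> 'k) \<in> completed_tensor_alg B" using insert wc by simp
    have "cmp (fun_scale (u w) (word_vec w) + (\<Sum>w\<in>I. fun_scale (u w) (word_vec w))) v =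
        cmp (fun_scale (u w) (word_vec w)) v + cmp (\<Sum>w\<in>I. fun_scale (u w) (word_vec w)) v"
      using cmp v w insert.prems wc unfolding is_tilde_comp_def
      by (blast intro: completed_scale completed_sum)
    moreover have "cmp (fun_scale (u w) (word_vec w)) v = fun_scale (u w) (cmp (word_vec w) v)"
      using cmp v w unfolding is_tilde_comp_def by blast
    moreover have "cmp (\<Sum>w\<in>I. fun_scale (u w) (word_vec w)) v =
        (\<Sum>w\<in>I. fun_scale (u w) (cmp (word_vec w) v))"
      using insert by simp
    ultimately show ?case by (simp only: sum.insert[OF insert.hyps])
  qed
  have "pairing_word (cmp u v) y = pairing_word (cmp u' v) y"
    using u' eq m(1) k by (intro pairing_word_cong) auto
  also have "\<dots> = (\<Sum>w\<in>A. u w * pairing_word (cmp (word_vec w) v) y)"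
    unfolding u'_def lin[OF A(1) order_refl]
  proof (rule pairing_word_sum[OF A(1)])
    show "cmp (word_vec w) v \<in> completed_tensor_alg B" if "w \<in> A" for w
      using cmp v wc[OF that] by (simp add: is_tilde_comp_def)
  qed
  also have "\<dots> = (\<Sum>w\<in>A. u w * coprod_value (word_pairing w) (pairing_word v) ?\<Delta>)"
    using A y by (intro sum.cong refl arg_cong2[where f = "(*)"]
        pairing_cmp_word[OF vs f basis basis' cmp v]) auto
  also have "\<dots> = form_ext (\<lambda>(a, M). (\<Sum>w\<in>A. u w * word_pairing w a) * monomial_value (pairing_word v) M) ?\<Delta>"
    unfolding coprod_value_def
    by (simp add: case_prod_unfold sum_distrib_right mult.assoc form_ext_fun_sum form_ext_mult_left)
  also have "\<dots> = coprod_value (pairing_word u) (pairing_word v) ?\<Delta>"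
    unfolding coprod_value_def
  proof (intro form_ext_cong, clarify)
    fix a M assume "(a, M) \<in> Poly_Mapping.keys ?\<Delta>"
    from m(2)[OF this] have "pairing_word u a = (\<Sum>w\<in>A. u w * word_pairing w a)"
      by (intro pairing_word_superset A) (auto simp: A_def)
    then show "(\<Sum>w\<in>A. u w * word_pairing w a) * monomial_value (pairing_word v) M =
        pairing_word u a * monomial_value (pairing_word v) M" by simp
  qed
  finally show ?thesis .
qed

theorem theorem15:
  fixes s :: "'k::field_char_0 \<Rightarrow> 'v::ab_group_add \<Rightarrow> 'v"
    and f :: "'v \<Rightarrow> 'v"
    and B :: "'v set" and B' :: "('v \<Rightarrow> 'k) set"
  assumes "vector_space s"
    and "Vector_Spaces.linear s s f"
    and "locally_nilpotent_on (dual_space s) (transpose_map f)"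
    and "is_basis s UNIV B"
    and "is_basis fun_scale (dual_space s) B'"
  shows "(\<exists>cmp. is_tilde_comp s B f cmp) \<and>
    (\<forall>cmp. is_tilde_comp s B f cmp \<longrightarrow>
      (\<forall>u\<in>completed_tensor_alg B. \<forall>v\<in>completed_tensor_alg B.
        convolution fun_scale B' (transpose_map f)
            (char_of_form B' (pairing u)) (char_of_form B' (pairing v)) =
          char_of_form B' (pairing (cmp u v) + pairing v)))"
proof (intro conjI allI impI ballI)
  obtain N where N: "\<forall>x. (f ^^ N) x = 0"
    using nilpotent_if_transpose_locally_nilpotent[OF assms(1-3)] .
  show "\<exists>cmp. is_tilde_comp s B f cmp"
    using is_tilde_comp_tilde_comp[OF assms(1,2) N assms(4)] by blast
  fix cmp and u v :: "'v list \<Rightarrow> 'k"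
  assume cmp: "is_tilde_comp s B f cmp"
    and u: "u \<in> completed_tensor_alg B" and v: "v \<in> completed_tensor_alg B"
  define \<phi> where "\<phi> = (\<lambda>w. coprod_value (pairing_word u) (pairing_word v)
      (delta_tilde fun_scale B' (transpose_map f) w) + pairing_word v w)"
  define \<psi> where "\<psi> = (\<lambda>w. pairing_word (cmp u v) w + pairing_word v w)"
  have "\<phi> y = \<psi> y" if "y \<in> lists B'" for y
    unfolding \<phi>_def \<psi>_def pairing_cmp[OF assms(1,2) N assms(4,5) cmp u v that] ..
  then have "monomial_value \<phi> M = monomial_value \<psi> M" if "set_mset M \<subseteq> lists B'" for M
    unfolding monomial_value_def using that
    by (intro arg_cong[where f = prod_mset] image_mset_cong) blast
  then have "form_ext (monomial_value \<phi>) P = form_ext (monomial_value \<psi>) P" if "P \<in> sym_alg B'" for P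
    using that by (intro form_ext_cong) (auto simp: sym_alg_def)
  then have "restrict (form_ext (monomial_value \<phi>)) (sym_alg B') =
      restrict (form_ext (monomial_value \<psi>)) (sym_alg B')"
    by (rule restrict_ext)
  moreover have "pairing (cmp u v) + pairing v = form_ext \<psi>"
    by (simp add: pairing_eq_form_ext fun_eq_iff \<psi>_def form_ext_fun_add)
  moreover have "convolution fun_scale B' (transpose_map f)
      (char_of_form B' (pairing u)) (char_of_form B' (pairing v)) =
      restrict (form_ext (monomial_value \<phi>)) (sym_alg B')"
    unfolding pairing_eq_form_ext convolution_char_of_form[OF vector_space_fun_scale] \<phi>_def ..
  ultimately show "convolution fun_scale B' (transpose_map f)
            (char_of_form B' (pairing u)) (char_of_form B' (pairing v)) =
          char_of_form B' (pairing (cmp u v) + pairing v)"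
    by (simp only: char_of_form_eq)
qed

end
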